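(* Let $B$ be an $(n_c,n_v)$-regular $n_cN_1\times n_vN_1$ parity-check matrix of a protograph-based QC-LDPC code (from the $n_c\times n_v$ all-one protograph) of girth $8$. Then there exist lifting factors $N$ for which $B$ can be lifted to obtain a QC-LDPC code with parity-check matrix $H_{n_c}$ of girth $20$ or $22$, as desired.
   Context: $B$ is an $n_c\times n_v$ array of $N_1\times N_1$ circulant permutation matrices (so it has column weight $n_c$ and row weight $n_v$). A lifting of $B$ with lifting factor $N$ is a matrix obtained by replacing each entry $1$ of $B$ by some $N\times N$ circulant permutation matrix and each entry $0$ by the $N\times N$ zero matrix. The Tanner graph of a $0/1$ matrix is the bipartite graph with one check node per row, one variable node per column, and an edge for each entry equal to $1$; the girth of a matrix (or of the code given by that parity-check matrix) is the length of a shortest cycle in its Tanner graph.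
   Formalization: Girth 20 is claimed only if n_c ≥ 3 or n_v ≥ 3, and girth 22 only if both are ≥ 3: for n_c = n_v = 2 all cycle lengths of a lifting are multiples of 8, and if n_c = 2 or n_v = 2 they are multiples of 4, so the unrestricted claim fails. *)

theory Defs
  imports "Jordan_Normal_Form.Matrix" "HOL-Library.Z2" "HOL-Library.Extended_Nat"
begin

text \<open>
  Parity-check matrices are matrices over the two-element field \<^typ>\<open>bit\<close>, so every matrix
  of type \<open>bit mat\<close> is a 0/1 matrix. Rows, columns and circulant blocks are indexed from 0.
\<close>

subsection \<open>Tanner graph and girth\<close>

text \<open>
  The check node of row \<open>i\<close> is \<open>Inl i\<close> and the variable node of column \<open>j\<close> is \<open>Inr j\<close>.
\<close>

definition tanner_adj :: "bit mat \<Rightarrow> nat + nat \<Rightarrow> nat + nat \<Rightarrow> bool" where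
  "tanner_adj H u v \<longleftrightarrow>
     (\<exists>i < dim_row H. \<exists>j < dim_col H. H $$ (i, j) = 1 \<and>
        (u = Inl i \<and> v = Inr j \<or> u = Inr j \<and> v = Inl i))"

text \<open>
  A cycle is given by the list of its vertices, without repeating the first one at the end. The
  length condition excludes going back and forth along one edge.
\<close>

definition graph_cycle :: "('v \<Rightarrow> 'v \<Rightarrow> bool) \<Rightarrow> 'v list \<Rightarrow> bool" where
  "graph_cycle adj vs \<longleftrightarrow>
     3 \<le> length vs \<and> distinct vs \<and>
     (\<forall>k < length vs. adj (vs ! k) (vs ! (Suc k mod length vs)))"

text \<open>The girth of an acyclic graph is \<open>\<infinity>\<close>, the infimum of the empty set.\<close>

definition girth :: "bit mat \<Rightarrow> enat" where
  "girth H = (INF vs \<in> {vs. graph_cycle (tanner_adj H) vs}. enat (length vs))"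

subsection \<open>Circulant permutation matrices and liftings\<close>

definition circulant_perm_mat :: "nat \<Rightarrow> nat \<Rightarrow> bit mat" where
  "circulant_perm_mat N s = mat N N (\<lambda>(a, b). if b = (a + s) mod N then 1 else 0)"

definition is_circulant_perm_mat :: "nat \<Rightarrow> bit mat \<Rightarrow> bool" where
  "is_circulant_perm_mat N A \<longleftrightarrow> (\<exists>s < N. A = circulant_perm_mat N s)"

definition mat_block :: "nat \<Rightarrow> 'a mat \<Rightarrow> nat \<Rightarrow> nat \<Rightarrow> 'a mat" where
  "mat_block N H i j = mat N N (\<lambda>(a, b). H $$ (i * N + a, j * N + b))"

text \<open>\<open>is_lifting B N H\<close>: \<open>H\<close> is a lifting of \<open>B\<close> with lifting factor \<open>N\<close>.\<close>

definition is_lifting :: "bit mat \<Rightarrow> nat \<Rightarrow> bit mat \<Rightarrow> bool" where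
  "is_lifting B N H \<longleftrightarrow>
     0 < N \<and> H \<in> carrier_mat (dim_row B * N) (dim_col B * N) \<and>
     (\<forall>i < dim_row B. \<forall>j < dim_col B.
        if B $$ (i, j) = 1 then is_circulant_perm_mat N (mat_block N H i j)
        else mat_block N H i j = 0\<^sub>m N N)"

definition all_one_protograph :: "nat \<Rightarrow> nat \<Rightarrow> bit mat" where
  "all_one_protograph n_c n_v = mat n_c n_v (\<lambda>_. 1)"

end

theory Submission
  imports Defs
begin

text \<open>
  A lifting is the derived graph of a voltage assignment on the edges of the Tanner graph, and its
  cycles correspond to the cyclically reduced closed walks of total voltage 0. Suppose a closed
  reduced walk \<open>W\<close> of length at most 24 never uses an edge in both directions and some edge only
  once. Take the voltages generic subject to \<open>W\<close> having total voltage 0. A closed reduced walk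
  shorter than \<open>W\<close> with total voltage 0 then has an edge count that is an integer multiple of that
  of \<open>W\<close>. Comparing the sums of absolute values, the multiple is 0; but a closed reduced walk using
  every edge equally often in both directions has length at least 24 when the girth is 8. So the
  lifting has girth exactly the length of \<open>W\<close>.

  The walk \<open>W\<close> runs through an 8-cycle and then through a cycle of length 12 or 14 sharing a path
  with it. The latter is the lift of a closed walk in the all-one protograph that has total voltage
  0 under every assignment (in a \<open>2 \<times> 3\<close> or \<open>3 \<times> 2\<close> block for 12, a \<open>3 \<times> 3\<close> block for 14).
  If the two cycles conflict in the direction of an edge, the 8-cycle can be exchanged for another.
\<close>

subsection \<open>Reduced closed walks\<close>

text \<open>Walks are lists of darts (oriented edges), so that voltages and edge counts become sums
  over the list.\<close>

primrec walk :: "('v \<Rightarrow> 'v \<Rightarrow> bool) \<Rightarrow> 'v \<Rightarrow> ('v \<times> 'v) list \<Rightarrow> 'v \<Rightarrow> bool" where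
  "walk adj u [] v \<longleftrightarrow> u = v"
| "walk adj u (d # ds) v \<longleftrightarrow> fst d = u \<and> adj u (snd d) \<and> walk adj (snd d) ds v"

definition nonbacktracking :: "('v \<times> 'v) list \<Rightarrow> bool" where
  "nonbacktracking = successively (\<lambda>d e. e \<noteq> prod.swap d)"

text \<open>Repeating the first dart at the end also forbids backtracking across the base point,
  which makes the notion invariant under rotation.\<close>

definition reduced_cycle :: "('v \<Rightarrow> 'v \<Rightarrow> bool) \<Rightarrow> ('v \<times> 'v) list \<Rightarrow> bool" where
  "reduced_cycle adj W \<longleftrightarrow> W \<noteq> [] \<and> (\<exists>u. walk adj u W u) \<and> nonbacktracking (W @ [hd W])"

definition reversal :: "('v \<times> 'v) list \<Rightarrow> ('v \<times> 'v) list" where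
  "reversal W = rev (map prod.swap W)"

definition edge_simple :: "('v \<times> 'v) list \<Rightarrow> bool" where
  "edge_simple W \<longleftrightarrow> distinct W \<and> (\<forall>d \<in> set W. prod.swap d \<notin> set W)"

lemma walk_append: "walk adj u (xs @ ys) v \<longleftrightarrow> (\<exists>w. walk adj u xs w \<and> walk adj w ys v)"
  by (induction xs arbitrary: u) auto

lemma walk_fst_hd: "walk adj u W v \<Longrightarrow> W \<noteq> [] \<Longrightarrow> fst (hd W) = u"
  by (cases W) auto

lemma walk_snd_last: "walk adj u W v \<Longrightarrow> W \<noteq> [] \<Longrightarrow> snd (last W) = v"
  by (induction W arbitrary: u) auto

lemma walk_adj: "walk adj u W v \<Longrightarrow> d \<in> set W \<Longrightarrow> adj (fst d) (snd d)"
  by (induction W arbitrary: u) auto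

lemma nonbacktracking_append:
  "nonbacktracking (xs @ ys) \<longleftrightarrow> nonbacktracking xs \<and> nonbacktracking ys \<and>
     (xs = [] \<or> ys = [] \<or> hd ys \<noteq> prod.swap (last xs))"
  by (simp add: nonbacktracking_def successively_append_iff)

lemma nonbacktracking_Cons:
  "nonbacktracking (x # ys) \<longleftrightarrow> nonbacktracking ys \<and> (ys = [] \<or> hd ys \<noteq> prod.swap x)"
  using nonbacktracking_append[of "[x]" ys] by (auto simp: nonbacktracking_def)

lemma nonbacktracking_simps [simp]: "nonbacktracking []" "nonbacktracking [x]"
  by (auto simp: nonbacktracking_def)

lemma reduced_cycle_nonempty: "reduced_cycle adj W \<Longrightarrow> W \<noteq> []"
  by (simp add: reduced_cycle_def)

lemma reduced_cycle_append:
  assumes "xs \<noteq> []" "ys \<noteq> []"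
  shows "reduced_cycle adj (xs @ ys) \<longleftrightarrow>
    (\<exists>u v. walk adj u xs v \<and> walk adj v ys u) \<and> nonbacktracking xs \<and> nonbacktracking ys \<and>
    hd ys \<noteq> prod.swap (last xs) \<and> hd xs \<noteq> prod.swap (last ys)"
  using assms by (auto simp: reduced_cycle_def walk_append nonbacktracking_append)

lemma reduced_cycle_rotate: "reduced_cycle adj (xs @ ys) \<Longrightarrow> reduced_cycle adj (ys @ xs)"
  by (cases "xs = [] \<or> ys = []") (auto simp: reduced_cycle_append)

lemma reduced_cycle_nonbacktracking: "reduced_cycle adj W \<Longrightarrow> nonbacktracking W"
  by (auto simp: reduced_cycle_def nonbacktracking_append)

lemma reduced_cycle_walk: "reduced_cycle adj W \<Longrightarrow> walk adj (fst (hd W)) W (fst (hd W))"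
  unfolding reduced_cycle_def using walk_fst_hd by metis

text \<open>At both junctions the next dart is \<open>hd P\<close>, which is also the dart that
  follows when each cycle is closed up on its own. This glues the 8-cycle to the long cycle.\<close>

lemma reduced_cycle_concat:
  assumes "P \<noteq> []" "reduced_cycle adj (P @ Q)" "reduced_cycle adj (P @ R)"
  shows "reduced_cycle adj ((P @ Q) @ (P @ R))"
proof (subst reduced_cycle_append)
  let ?u = "fst (hd P)"
  have w: "walk adj ?u (P @ Q) ?u" "walk adj ?u (P @ R) ?u"
    using reduced_cycle_walk[OF assms(2)] reduced_cycle_walk[OF assms(3)] assms(1) by auto
  have n: "nonbacktracking ((P @ Q) @ [hd P])" "nonbacktracking ((P @ R) @ [hd P])"
    using assms by (auto simp: reduced_cycle_def)
  show "(\<exists>u v. walk adj u (P @ Q) v \<and> walk adj v (P @ R) u) \<and> nonbacktracking (P @ Q) \<and>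
      nonbacktracking (P @ R) \<and> hd (P @ R) \<noteq> prod.swap (last (P @ Q)) \<and>
      hd (P @ Q) \<noteq> prod.swap (last (P @ R))"
    using w n assms(1) unfolding nonbacktracking_append[of "P @ Q" "[hd P]"]
      nonbacktracking_append[of "P @ R" "[hd P]"] by auto
qed (use assms in auto)

lemma reversal_simps [simp]:
  "reversal [] = []" "reversal (xs @ ys) = reversal ys @ reversal xs"
  "reversal (x # xs) = reversal xs @ [prod.swap x]"
  "length (reversal xs) = length xs" "set (reversal xs) = prod.swap ` set xs"
  by (auto simp: reversal_def)

lemma mem_swap_image [simp]: "d \<in> prod.swap ` S \<longleftrightarrow> prod.swap d \<in> S"
  by (metis image_iff swap_swap)

lemma nonbacktracking_reversal: "nonbacktracking W \<Longrightarrow> nonbacktracking (reversal W)"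
proof (induction W)
  case (Cons d W)
  show ?case
  proof (cases W)
    case (Cons e W')
    then show ?thesis using Cons.IH Cons.prems
      by (auto simp: nonbacktracking_append nonbacktracking_Cons)
  qed simp
qed simp

lemma edge_simple_split:
  assumes "edge_simple (xs @ b # ys)"
  shows "b \<notin> set (xs @ ys)" "prod.swap b \<notin> set (xs @ ys)"
  using assms by (auto simp: edge_simple_def)

text \<open>Meant for two walks leaving a common vertex: joined there, they share no edge in any
  orientation.\<close>

lemma edge_simple_reversal_append:
  assumes "edge_simple (reversal xs @ ys)"
  shows "set xs \<inter> set ys = {}" "set xs \<inter> prod.swap ` set ys = {}"
    "prod.swap ` set xs \<inter> prod.swap ` set ys = {}" "distinct xs"
    "set xs \<inter> prod.swap ` set xs = {}"
proof -
  have *: "distinct (reversal xs)" "prod.swap ` set xs \<inter> set ys = {}"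
    and opp: "\<And>d. prod.swap d \<in> set xs \<or> d \<in> set ys \<Longrightarrow> d \<notin> set xs \<and> prod.swap d \<notin> set ys"
    using assms by (simp_all add: edge_simple_def ball_Un) blast
  show "distinct xs" using *(1) by (simp add: reversal_def distinct_map)
  show disj: "set xs \<inter> set ys = {}" using opp by blast
  show "set xs \<inter> prod.swap ` set ys = {}"
    using *(2) unfolding disjoint_iff mem_swap_image by (metis swap_swap)
  show "prod.swap ` set xs \<inter> prod.swap ` set ys = {}"
    using disj unfolding disjoint_iff mem_swap_image by blast
  show "set xs \<inter> prod.swap ` set xs = {}"
    unfolding disjoint_iff mem_swap_image using opp by blast
qed

text \<open>Loops are split off because a loop is its own reversal, so that a single occurrence
  already violates edge-simplicity.\<close>

lemma not_edge_simpleE: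
  assumes "\<not> edge_simple W"
  obtains xs d ys e zs where "W = xs @ d # ys @ e # zs" "e = d \<or> e = prod.swap d"
    "fst d \<noteq> snd d"
  | d where "d \<in> set W" "fst d = snd d"
proof (cases "\<exists>d \<in> set W. fst d = snd d")
  case False
  have "\<exists>xs d ys e zs. W = xs @ d # ys @ e # zs \<and> (e = d \<or> e = prod.swap d)"
  proof (cases "distinct W")
    case True
    then obtain d where d: "d \<in> set W" "prod.swap d \<in> set W"
      using assms by (auto simp: edge_simple_def)
    then obtain xs ys where W: "W = xs @ d # ys" by (meson split_list)
    have "prod.swap d \<noteq> d" using False d(1) by (metis fst_swap)
    then consider "prod.swap d \<in> set xs" | "prod.swap d \<in> set ys" using d(2) W by auto
    then show ?thesis
    proof cases
      case 1
      then obtain as bs where "xs = as @ prod.swap d # bs" by (meson split_list)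
      then have "W = as @ prod.swap d # bs @ d # ys \<and> (d = prod.swap d \<or> d = prod.swap (prod.swap d))"
        using W by simp
      then show ?thesis by blast
    next
      case 2
      then obtain as bs where "ys = as @ prod.swap d # bs" by (meson split_list)
      then show ?thesis using W by blast
    qed
  next
    case False
    then obtain xs ys zs d where "W = xs @ [d] @ ys @ [d] @ zs" using not_distinct_decomp by blast
    then have "W = xs @ d # ys @ d # zs" by simp
    then show ?thesis by blast
  qed
  then show ?thesis using False that(1) by force
qed (use that in blast)

lemma even_pair_sum_18:
  fixes m n :: nat
  assumes "even m" "even n" "8 \<le> m" "8 \<le> n" "m + n \<le> 18"
  shows "m = 8 \<or> n = 8"
  using assms by presburger

section \<open>Vertex cycles and closed walks of darts\<close>

lemma reduced_cycle_of_graph_cycle: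
  assumes "graph_cycle adj vs"
  obtains W where "reduced_cycle adj W" "length W = length vs"
    "\<And>k. k < length vs \<Longrightarrow> W ! k = (vs ! k, vs ! (Suc k mod length vs))"
proof -
  define n where "n = length vs"
  define f where "f k = vs ! (k mod n)" for k
  define W where "W = map (\<lambda>k. (f k, f (Suc k))) [0..<n]"
  have n: "n \<ge> 3" "distinct vs" "\<And>k. k < n \<Longrightarrow> adj (f k) (f (Suc k))"
    using assms by (auto simp: graph_cycle_def n_def f_def)
  have "walk adj (f 0) (map (\<lambda>k. (f k, f (Suc k))) [0..<m]) (f m)" if "m \<le> n" for m
    using that by (induction m) (auto simp: walk_append n)
  from this[of n] have w: "walk adj (f 0) W (f 0)" by (simp add: W_def f_def)
  have ne: "f k \<noteq> f (Suc (Suc k))" if "k < n" for k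
  proof -
    have "k mod n \<noteq> Suc (Suc k) mod n"
    proof (cases "Suc (Suc k) < n")
      case False
      then have "Suc (Suc k) mod n = Suc (Suc k) - n"
        using that n(1) by (auto simp: mod_if)
      moreover have "k mod n = k" using that by simp
      moreover have "k \<noteq> Suc (Suc k) - n" using that n(1) False by arith
      ultimately show ?thesis by simp
    qed (use that in simp)
    moreover have "k mod n < length vs" "Suc (Suc k) mod n < length vs"
      using n(1) by (auto simp: n_def intro: mod_less_divisor)
    ultimately show ?thesis using n(2) by (simp add: f_def nth_eq_iff_index_eq)
  qed
  \<comment> \<open>The range includes \<open>n\<close>: by periodicity of \<open>f\<close> the
    extra dart is the first one again, which gives the cyclic condition.\<close>
  have "nonbacktracking (map (\<lambda>k. (f k, f (Suc k))) [0..<Suc n])"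
    unfolding nonbacktracking_def successively_conv_nth
    using ne[symmetric] by (auto simp del: upt_Suc)
  moreover have "hd W = (f n, f (Suc n))"
    using n(1) by (simp add: W_def hd_map f_def mod_Suc)
  ultimately have "nonbacktracking (W @ [hd W])" by (simp add: W_def)
  then have "reduced_cycle adj W" using w n(1) by (auto simp: reduced_cycle_def W_def)
  then show ?thesis
    by (rule that) (auto simp: W_def f_def n_def)
qed

text \<open>A shortest stretch between two equal vertices of the walk is a cycle; lengths 1 and 2
  are excluded by irreflexivity and by the lack of backtracking.\<close>

lemma graph_cycle_of_nonbacktracking:
  assumes irr: "\<And>u. \<not> adj u u"
    and W: "walk adj u W u" "W \<noteq> []" "nonbacktracking W"
  obtains vs where "graph_cycle adj vs" "length vs \<le> length W"
proof -
  define n where "n = length W"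
  \<comment> \<open>\<open>p k\<close> is the k-th vertex; the default \<open>u\<close> is the end
    point \<open>p n\<close>, equal to \<open>p 0\<close>.\<close>
  define p where "p k = (if k < n then fst (W ! k) else u)" for k
  have link: "snd (W ! k) = p (Suc k)" if "k < n" for k
  proof -
    have "walk adj u (take (Suc k) W @ drop (Suc k) W) u" using W by simp
    then obtain w where w: "walk adj u (take (Suc k) W) w" "walk adj w (drop (Suc k) W) u"
      by (auto simp: walk_append simp del: append_take_drop_id)
    have "snd (W ! k) = w" using walk_snd_last[OF w(1)] W(2) that
      by (simp add: take_Suc_conv_app_nth n_def)
    moreover have "w = p (Suc k)"
    proof (cases "Suc k < n")
      case True then show ?thesis using walk_fst_hd[OF w(2)] by (simp add: hd_drop_conv_nth p_def n_def)
    next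
      case False then show ?thesis using w(2) by (simp add: p_def n_def)
    qed
    ultimately show ?thesis by simp
  qed
  have dart: "W ! k = (p k, p (Suc k))" if "k < n" for k
    using link[OF that] that by (simp add: p_def prod_eq_iff)
  have adj: "adj (p k) (p (Suc k))" if "k < n" for k
    using walk_adj[OF W(1) nth_mem, of k] dart[OF that] that by (simp add: n_def)
  have nb: "p k \<noteq> p (Suc (Suc k))" if "Suc k < n" for k
    using W(3) that dart[of k] dart[of "Suc k"]
    by (auto simp: nonbacktracking_def successively_conv_nth n_def)
  have "fst (W ! 0) = u" using walk_fst_hd[OF W(1,2)] W(2) by (simp add: hd_conv_nth)
  then have p0: "p 0 = p n" "n > 0" using W(2) by (auto simp: p_def n_def)
  define S where "S l \<longleftrightarrow> 0 < l \<and> (\<exists>i. i + l \<le> n \<and> p i = p (i + l))" for l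
  have Sn: "S n" using p0 by (auto simp: S_def)
  define l where "l = (LEAST l. S l)"
  have Sl: "S l" unfolding l_def using Sn by (rule LeastI)
  have min: "\<not> S m" if "m < l" for m using that unfolding l_def by (rule not_less_Least)
  have ln: "l \<le> n" unfolding l_def using Sn by (rule Least_le)
  obtain i where i: "i + l \<le> n" "p i = p (i + l)" "l > 0" using Sl by (auto simp: S_def)
  have "l \<noteq> 1" using adj[of i] i irr by auto
  moreover have "l \<noteq> 2" using nb[of i] i by auto
  ultimately have l3: "l \<ge> 3" using i by simp
  define vs where "vs = map p [i..<i + l]"
  have "inj_on p {i..<i + l}"
  proof (rule linorder_inj_onI)
    fix a b assume ab: "a < b" "a \<in> {i..<i + l}" "b \<in> {i..<i + l}"
    show "p a \<noteq> p b"
    proof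
      assume "p a = p b"
      then have "S (b - a)" using ab i by (auto simp: S_def intro!: exI[of _ a])
      moreover have "b - a < l" using ab by auto
      ultimately show False using min by blast
    qed
  qed auto
  then have "distinct vs" by (simp add: vs_def distinct_map)
  moreover have "adj (vs ! k) (vs ! (Suc k mod length vs))" if "k < length vs" for k
  proof (cases "Suc k < l")
    case False
    then have "Suc k = l" using that by (simp add: vs_def)
    then show ?thesis using adj[of "i + k"] i l3 by (auto simp: vs_def)
  qed (use adj[of "i + k"] i in \<open>simp add: vs_def\<close>)
  ultimately have "graph_cycle adj vs" using l3 by (auto simp: graph_cycle_def vs_def)
  then show ?thesis using that ln by (simp add: vs_def n_def)
qed

section \<open>Bipartite graphs of girth at least 8\<close>

text \<open>The length bound covers walks that backtrack at their base point, because segments cut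
  out of longer walks are only known to be nonbacktracking inside.\<close>

locale girth8_graph =
  fixes adj :: "'v \<Rightarrow> 'v \<Rightarrow> bool" and side :: "'v \<Rightarrow> bool"
  assumes sym: "adj u v \<Longrightarrow> adj v u"
    and bipartite: "adj u v \<Longrightarrow> side v \<longleftrightarrow> \<not> side u"
    and girth8: "walk adj u W u \<Longrightarrow> W \<noteq> [] \<Longrightarrow> nonbacktracking W \<Longrightarrow> 8 \<le> length W"
begin

lemma irrefl: "\<not> adj u u"
  using bipartite by blast

lemma walk_reversal: "walk adj u W v \<Longrightarrow> walk adj v (reversal W) u"
  by (induction W arbitrary: u) (auto simp: walk_append sym)

lemma walk_even: "walk adj u W v \<Longrightarrow> even (length W) \<longleftrightarrow> (side u \<longleftrightarrow> side v)"
proof (induction W arbitrary: u)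
  case (Cons d W)
  then show ?case using bipartite[of u "snd d"] by auto
qed auto

lemma closed_even: "walk adj u W u \<Longrightarrow> even (length W)"
  by (simp add: walk_even)

text \<open>Cancelling a backtrack keeps the end points and still avoids \<open>x\<close>. What
  remains is nonempty, as \<open>x\<close> is no loop, and closes up with \<open>x\<close> to a
  reduced cycle. Length 7 leaves no room for a cancellation, since the shortened walk would violate
  the bound.\<close>

lemma avoiding_walk_reduced:
  assumes "walk adj (snd x) W (fst x)" "adj (fst x) (snd x)" "x \<notin> set W" "prod.swap x \<notin> set W"
  shows "8 \<le> Suc (length W) \<and> (length W = 7 \<longrightarrow> reduced_cycle adj (x # W))"
  using assms
proof (induction "length W" arbitrary: W rule: less_induct)
  case less
  show ?case
  proof (cases "nonbacktracking W")
    case True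
    have "W \<noteq> []" using less.prems irrefl by (cases W) auto
    then have "hd W \<noteq> prod.swap x" "last W \<in> set W" "x \<noteq> prod.swap (last W)"
      using less.prems by (metis hd_in_set, simp, metis last_in_set swap_swap)
    then have nb: "nonbacktracking ((x # W) @ [x])"
      using True \<open>W \<noteq> []\<close> by (auto simp: nonbacktracking_append nonbacktracking_Cons)
    have w: "walk adj (fst x) (x # W) (fst x)" using less.prems by simp
    have "8 \<le> length (x # W)"
      using girth8[OF w] nb by (metis list.distinct(1) nonbacktracking_append)
    then show ?thesis using w nb by (auto simp: reduced_cycle_def)
  next
    case False
    then obtain i where i: "Suc i < length W" "W ! Suc i = prod.swap (W ! i)"
      by (auto simp: nonbacktracking_def successively_conv_nth)
    define xs ys where "xs = take i W" and "ys = drop (Suc (Suc i)) W"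
    have W: "W = xs @ W ! i # prod.swap (W ! i) # ys"
      using i unfolding xs_def ys_def
      by (metis Cons_nth_drop_Suc Suc_lessD append_take_drop_id)
    then obtain d where W: "W = xs @ d # prod.swap d # ys" by blast
    have "8 \<le> Suc (length (xs @ ys))"
      using less.hyps[of "xs @ ys"] less.prems unfolding W by (auto simp: walk_append)
    then show ?thesis using W by simp
  qed
qed

text \<open>Rotate the walk to start at \<open>x\<close>. A closed walk glued from pieces is thus
  recognised as reduced from its length 8 alone, without inspecting the junctions.\<close>

lemma closed_walk_once:
  assumes "walk adj u (xs @ x # ys) u" "x \<notin> set (xs @ ys)" "prod.swap x \<notin> set (xs @ ys)"
  shows "8 \<le> length (xs @ x # ys)"
    "length (xs @ x # ys) = 8 \<Longrightarrow> reduced_cycle adj (xs @ x # ys)"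
proof -
  have a: "walk adj (snd x) (ys @ xs) (fst x)" "adj (fst x) (snd x)"
    using assms(1) by (auto simp: walk_append)
  note * = avoiding_walk_reduced[OF a]
  show "8 \<le> length (xs @ x # ys)" using * assms(2,3) by auto
  assume "length (xs @ x # ys) = 8"
  then have "reduced_cycle adj ((x # ys) @ xs)" using * assms(2,3) by auto
  then show "reduced_cycle adj (xs @ x # ys)" using reduced_cycle_rotate by blast
qed

text \<open>A repeated edge cuts out a closed nonbacktracking segment strictly shorter than the
  walk, hence of length below 8.\<close>

lemma nonbacktracking_edge_simple:
  assumes "walk adj u W v" "nonbacktracking W" "length W \<le> 8"
  shows "edge_simple W"
proof (rule ccontr)
  assume "\<not> edge_simple W"
  then show False
  proof (cases rule: not_edge_simpleE)
    case (1 xs d ys e zs)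
    note W = \<open>W = xs @ d # ys @ e # zs\<close>
    show ?thesis
    proof (cases "e = d")
      case True
      then have "walk adj (fst d) (d # ys) (fst d)" using assms(1) unfolding W
        by (auto simp: walk_append)
      moreover have "nonbacktracking (d # ys)" using assms(2) unfolding W
        by (auto simp: nonbacktracking_append nonbacktracking_Cons)
      ultimately show ?thesis using girth8[of "fst d" "d # ys"] assms(3) W by simp
    next
      case False
      then have e: "e = prod.swap d" using 1 by simp
      then have "walk adj (snd d) ys (snd d)" using assms(1) unfolding W
        by (auto simp: walk_append)
      moreover have "nonbacktracking ys" "ys \<noteq> []" using assms(2) e unfolding W
        by (auto simp: nonbacktracking_append nonbacktracking_Cons)
      ultimately show ?thesis using girth8[of "snd d" ys] assms(3) W by simp
    qed
  next
    case (2 d)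
    then show ?thesis using walk_adj[OF assms(1)] irrefl by metis
  qed
qed

text \<open>A repeated edge splits the cycle into two closed nonbacktracking walks, after deleting
  both occurrences if their directions differ. Each has length at least 8, hence the bound
  16.\<close>

lemma reduced_cycle_edge_simple:
  assumes "reduced_cycle adj W" "length W < 16"
  shows "edge_simple W"
proof (rule ccontr)
  obtain u where w: "walk adj u W u" using assms(1) by (auto simp: reduced_cycle_def)
  assume "\<not> edge_simple W"
  then show False
  proof (cases rule: not_edge_simpleE)
    case (1 xs d ys e zs)
    note W = \<open>W = xs @ d # ys @ e # zs\<close>
    have r: "reduced_cycle adj ((d # ys) @ (e # zs @ xs))"
      using reduced_cycle_rotate[of adj xs "d # ys @ e # zs"] assms(1) W by simp
    then obtain v w where vw: "walk adj v (d # ys) w" "walk adj w (e # zs @ xs) v"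
      and nb: "nonbacktracking (d # ys)" "nonbacktracking (e # zs @ xs)"
      and hl: "e \<noteq> prod.swap (last (d # ys))" "d \<noteq> prod.swap (last (e # zs @ xs))"
      unfolding reduced_cycle_append[OF list.distinct(2) list.distinct(2)] by auto
    show ?thesis
    proof (cases "e = d")
      case True
      then have "v = w" using vw by simp
      then have "8 \<le> length (d # ys)" "8 \<le> length (e # zs @ xs)"
        using girth8[OF _ list.distinct(2) nb(1)] girth8[OF _ list.distinct(2) nb(2)] vw by auto
      then show ?thesis using assms(2) W by simp
    next
      case False
      then have e: "e = prod.swap d" using 1 by simp
      have ne: "ys \<noteq> []" "zs @ xs \<noteq> []" using hl e by (metis last.simps, metis last.simps swap_swap)
      have "walk adj (snd d) ys (snd d)" "walk adj (fst d) (zs @ xs) (fst d)"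
        using vw e by auto
      moreover have "nonbacktracking ys" "nonbacktracking (zs @ xs)"
        using nb by (simp_all only: nonbacktracking_Cons)
      ultimately have "8 \<le> length ys" "8 \<le> length (zs @ xs)"
        using ne girth8 by blast+
      then show ?thesis using assms(2) W by simp
    qed
  next
    case (2 d)
    then show ?thesis using walk_adj[OF w] irrefl by metis
  qed
qed

section \<open>Overlapping cycles without opposite directions\<close>

text \<open>An edge run in opposite directions lies outside \<open>P\<close> on both cycles and
  yields two closed walks that each use it exactly once. Their lengths add up to
  \<open>length Q + length R\<close>, at most 12, although each is at least 8.\<close>

lemma long_overlap_no_opposite:
  assumes C: "reduced_cycle adj (P @ Q)" "length (P @ Q) = 8"
    and D: "reduced_cycle adj (P @ R)" "length (P @ R) \<le> 14"
    and P: "5 \<le> length P"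
  shows "\<forall>b \<in> set (P @ R). prod.swap b \<notin> set (P @ Q)"
proof (rule ccontr)
  assume "\<not> ?thesis"
  then obtain b where b: "b \<in> set (P @ R)" "prod.swap b \<in> set (P @ Q)" by auto
  have es: "edge_simple (P @ Q)" "edge_simple (P @ R)"
    using reduced_cycle_edge_simple C D by auto
  have "b \<in> set R" "prod.swap b \<in> set Q" using b es by (auto simp: edge_simple_def)
  then obtain R1 R2 Q1 Q2 where R: "R = R1 @ b # R2" and Q: "Q = Q1 @ prod.swap b # Q2"
    by (meson split_list)
  have bR: "b \<notin> set (R1 @ R2)" "prod.swap b \<notin> set (R1 @ R2)"
    using edge_simple_split[of "P @ R1" b R2] es(2) unfolding R by auto
  have bQ: "b \<notin> set (Q1 @ Q2)" "prod.swap b \<notin> set (Q1 @ Q2)"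
    using edge_simple_split[of "P @ Q1" "prod.swap b" Q2] es(1) unfolding Q by auto
  define u where "u = fst (hd P)"
  have "P \<noteq> []" using P by auto
  then have "walk adj u (P @ Q) u" "walk adj u (P @ R) u"
    using reduced_cycle_walk[OF C(1)] reduced_cycle_walk[OF D(1)] by (auto simp: u_def)
  moreover have "w = snd (last P)" if "walk adj u P w" for w
    using walk_snd_last[OF that] \<open>P \<noteq> []\<close> by simp
  ultimately obtain w where w: "walk adj w Q u" "walk adj w R u"
    unfolding walk_append by metis
  have q: "walk adj w Q1 (snd b)" "walk adj (fst b) Q2 u"
    and r: "walk adj w R1 (fst b)" "walk adj (snd b) R2 u" "adj (fst b) (snd b)"
    using w unfolding Q R by (auto simp: walk_append)
  \<comment> \<open>From the end \<open>w\<close> of \<open>P\<close> along \<open>R\<close> through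
    \<open>b\<close> and back along \<open>Q\<close>; the second walk does the same on the side of
    \<open>u\<close>.\<close>
  have 1: "8 \<le> length (R1 @ b # reversal Q1)"
  proof (rule closed_walk_once(1))
    show "walk adj w (R1 @ b # reversal Q1) w"
      using r q walk_reversal by (auto simp: walk_append)
  qed (use bR bQ in auto)
  have 2: "8 \<le> length ([] @ b # R2 @ reversal Q2)"
  proof (rule closed_walk_once(1))
    show "walk adj (fst b) ([] @ b # R2 @ reversal Q2) (fst b)"
      using r q walk_reversal by (auto simp: walk_append)
  qed (use bR bQ in auto)
  show False using 1 2 P C(2) D(2) R Q by simp
qed

text \<open>
  Let \<open>A @ X @ b # Y\<close> be the long cycle and \<open>A @ S @ prod.swap b # T\<close> the 8-cycle. The closed walks
  \<open>A @ X @ T\<close> and \<open>X @ b # reversal S\<close> have total length \<open>2 |X| + 8\<close>, and those through \<open>Y\<close> have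
  total length \<open>2 |Y| + 8\<close>. Since \<open>|X| + |Y| \<le> 11\<close>, one of the four has length exactly 8, and it
  agrees with the long cycle on at least 5 consecutive edges.
\<close>

lemma compatible_cycles:
  assumes C: "reduced_cycle adj (A @ C2)" "length (A @ C2) = 8"
    and D: "reduced_cycle adj (A @ D2)" "length (A @ D2) \<le> 14"
    and A: "length A = 2"
  obtains P Q R where "P \<noteq> []" "reduced_cycle adj (P @ Q)" "reduced_cycle adj (P @ R)"
    "length (P @ Q) = 8" "length (P @ R) = length (A @ D2)"
    "\<forall>b \<in> set (P @ R). prod.swap b \<notin> set (P @ Q)"
proof (cases "\<forall>b \<in> set (A @ D2). prod.swap b \<notin> set (A @ C2)")
  case True
  then show ?thesis using that[of A C2 D2] C D A by fastforce
next
  note result = that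
  case False
  then obtain b where b: "b \<in> set (A @ D2)" "prod.swap b \<in> set (A @ C2)" by blast
  have es: "edge_simple (A @ C2)" "edge_simple (A @ D2)"
    using reduced_cycle_edge_simple C D by auto
  have "b \<in> set D2" "prod.swap b \<in> set C2" using b es by (auto simp: edge_simple_def)
  then obtain X Y S T where D2: "D2 = X @ b # Y" and C2: "C2 = S @ prod.swap b # T"
    by (meson split_list)
  obtain a a' where Aa: "A = [a, a']"
    using A by (metis (no_types) One_nat_def Suc_1 length_0_conv length_Suc_conv)
  have bX: "b \<notin> set (X @ Y)" "prod.swap b \<notin> set (X @ Y)"
    using edge_simple_split[of "A @ X" b Y] es(2) unfolding D2 by auto
  have bS: "b \<notin> set (S @ T)" "prod.swap b \<notin> set (S @ T)"
    using edge_simple_split[of "A @ S" "prod.swap b" T] es(1) unfolding C2 by auto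
  have aX: "a \<notin> set (a' # X @ Y)" "prod.swap a \<notin> set (a' # X @ Y)"
    using edge_simple_split[of "[]" a "a' # X @ b # Y"] es(2) unfolding D2 Aa by auto
  have aS: "a \<notin> set (S @ T)" "prod.swap a \<notin> set (S @ T)"
    using edge_simple_split[of "[]" a "a' # S @ prod.swap b # T"] es(1) unfolding C2 Aa by auto
  define u where "u = fst a"
  have "walk adj u (A @ C2) u" "walk adj u (A @ D2) u"
    using reduced_cycle_walk[OF C(1)] reduced_cycle_walk[OF D(1)] by (auto simp: u_def Aa)
  then obtain w where w: "walk adj u A w" "walk adj w C2 u" "walk adj w D2 u"
    by (auto simp: Aa)
  have s: "walk adj w S (snd b)" "walk adj (fst b) T u"
    and x: "walk adj w X (fst b)" "walk adj (snd b) Y u" "adj (fst b) (snd b)"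
    using w unfolding C2 D2 by (auto simp: walk_append)
  have len: "length S + length T = 5" "length X + length Y \<le> 11"
    using C(2) D(2) by (auto simp: Aa C2 D2)
  have D': "reduced_cycle adj ((A @ X) @ b # Y)" using D(1) by (simp add: D2)
  \<comment> \<open>An 8-cycle that shares at least 5 consecutive edges with the long cycle
    suffices, by \<open>long_overlap_no_opposite\<close>.\<close>
  have concl: thesis
    if "reduced_cycle adj (P @ Q)" "length (P @ Q) = 8" "reduced_cycle adj (P @ R)"
       "length (P @ R) = length (A @ D2)" "5 \<le> length P" for P Q R
    using that(1-4) long_overlap_no_opposite[OF that(1,2,3) _ that(5)] that(5) D(2)
    by (intro result[of P Q R]) auto
  consider "length X \<le> 5" | "length Y \<le> 5" using len by linarith
  then show ?thesis
  proof cases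
    case 1
    have w1: "walk adj u ([] @ a # (a' # X @ T)) u"
      using w(1) s x by (auto simp: Aa walk_append)
    have w2: "walk adj w (X @ b # reversal S) w"
      using s x walk_reversal by (auto simp: walk_append)
    have "a \<notin> set ([] @ a' # X @ T)" "prod.swap a \<notin> set ([] @ a' # X @ T)"
      using aX aS by auto
    note c1 = closed_walk_once[OF w1 this]
    have "b \<notin> set (X @ reversal S)" "prod.swap b \<notin> set (X @ reversal S)"
      using bX bS by auto
    note c2 = closed_walk_once[OF w2 this]
    have ev: "even (length ([] @ a # (a' # X @ T)))" "even (length (X @ b # reversal S))"
      using closed_even w1 w2 by blast+
    have "length ([] @ a # (a' # X @ T)) + length (X @ b # reversal S) \<le> 18"
      using len 1 by simp
    \<comment> \<open>Two even lengths, both different from 8, would be at least 10 each and exceed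
      18 together.\<close>
    from this consider "length ([] @ a # (a' # X @ T)) = 8" | "length (X @ b # reversal S) = 8"
      using even_pair_sum_18[OF ev c1(1) c2(1)] by blast
    \<comment> \<open>Both lengths are at least 8 and their sum is \<open>2 * length X + 8\<close>;
      hence the overlaps \<open>A @ X\<close> and \<open>X @ [b]\<close> below have at least 5
      edges.\<close>
    moreover have X4: "4 \<le> length X" using c1(1) c2(1) len by simp
    ultimately show ?thesis
    proof cases
      case 1
      show ?thesis
        by (rule concl[of "A @ X" T "b # Y"]) (use c1(2)[OF 1] 1 D' X4 in \<open>auto simp: Aa D2\<close>)
    next
      case 2
      have "reduced_cycle adj ((X @ [b]) @ Y @ A)"
        using reduced_cycle_rotate[of adj A "X @ b # Y"] D' by simp
      then show ?thesis
        by (intro concl[of "X @ [b]" "reversal S" "Y @ A"])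
           (use c2(2)[OF 2] 2 X4 in \<open>auto simp: Aa D2\<close>)
    qed
  next
    case 2
    have w1: "walk adj (snd b) (Y @ a # (a' # S)) (snd b)"
      using w(1) s x by (auto simp: Aa walk_append)
    have w2: "walk adj (fst b) ([] @ b # (Y @ reversal T)) (fst b)"
      using s x walk_reversal by (auto simp: walk_append)
    have "a \<notin> set (Y @ a' # S)" "prod.swap a \<notin> set (Y @ a' # S)"
      using aX aS by auto
    note c1 = closed_walk_once[OF w1 this]
    have "b \<notin> set ([] @ Y @ reversal T)" "prod.swap b \<notin> set ([] @ Y @ reversal T)"
      using bX bS by auto
    note c2 = closed_walk_once[OF w2 this]
    have ev: "even (length (Y @ a # (a' # S)))" "even (length ([] @ b # (Y @ reversal T)))"
      using closed_even w1 w2 by blast+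
    have "length (Y @ a # (a' # S)) + length ([] @ b # (Y @ reversal T)) \<le> 18"
      using len 2 by simp
    then consider "length (Y @ a # (a' # S)) = 8" | "length ([] @ b # (Y @ reversal T)) = 8"
      using even_pair_sum_18[OF ev c1(1) c2(1)] by blast
    moreover have Y4: "4 \<le> length Y" using c1(1) c2(1) len by simp
    ultimately show ?thesis
    proof cases
      case 1
      have "reduced_cycle adj ((Y @ A) @ X @ [b])"
        using reduced_cycle_rotate[of adj "A @ X @ [b]" Y] D' by simp
      then show ?thesis
        by (intro concl[of "Y @ A" S "X @ [b]"]) (use c1(2)[OF 1] 1 Y4 in \<open>auto simp: Aa D2\<close>)
    next
      case 2
      have "reduced_cycle adj ((b # Y) @ A @ X)"
        using reduced_cycle_rotate[of adj "A @ X" "b # Y"] D' by simp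
      then show ?thesis
        by (intro concl[of "b # Y" "reversal T" "A @ X"])
           (use c2(2)[OF 2] 2 Y4 in \<open>auto simp: Aa D2\<close>)
    qed
  qed
qed

section \<open>Closed walks using every edge in both directions\<close>

text \<open>To run an edge backwards without backtracking, the walk has to turn round through a
  closed segment; where this segment is entered and left, three different edges meet.\<close>

lemma swap_closed_branch:
  assumes W: "reduced_cycle adj W" and sw: "\<And>d. d \<in> set W \<Longrightarrow> prod.swap d \<in> set W"
  obtains y1 y2 y3 where "{y1, y2, y3} \<subseteq> set W" "fst y1 = fst y2" "fst y2 = fst y3"
    "y1 \<noteq> y2" "y1 \<noteq> y3" "y2 \<noteq> y3"
proof -
  obtain u where w: "walk adj u W u" using W by (auto simp: reduced_cycle_def)
  have nb: "nonbacktracking W" using W by (rule reduced_cycle_nonbacktracking)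
  have ir: "d \<noteq> prod.swap d" if "d \<in> set W" for d
    using walk_adj[OF w that] irrefl by (metis fst_swap)
  \<comment> \<open>An innermost pair \<open>d \<dots> prod.swap d\<close>: the segment in between starts and ends with different edges.\<close>
  define S where "S l \<longleftrightarrow> (\<exists>xs d ys zs. W = xs @ d # ys @ prod.swap d # zs \<and> length ys = l)" for l
  have "\<exists>l. S l"
  proof -
    have "\<not> edge_simple W" using sw W by (auto simp: edge_simple_def reduced_cycle_def)
      (metis list.set_intros(1) neq_Nil_conv old.prod.exhaust swap_simp)
    then obtain d where d: "d \<in> set W" "prod.swap d \<in> set W"
      using sw W reduced_cycle_nonempty[OF W] by (meson hd_in_set)
    then obtain xs ys where Wd: "W = xs @ d # ys" by (meson split_list)
    then consider "prod.swap d \<in> set xs" | "prod.swap d \<in> set ys" using d ir[OF d(1)] by auto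
    then show ?thesis
    proof cases
      case 1
      then obtain as bs where "xs = as @ prod.swap d # bs" by (meson split_list)
      then have "W = as @ prod.swap d # bs @ prod.swap (prod.swap d) # ys" using Wd by simp
      then show ?thesis unfolding S_def by blast
    next
      case 2
      then obtain as bs where "ys = as @ prod.swap d # bs" by (meson split_list)
      then show ?thesis unfolding S_def using Wd by blast
    qed
  qed
  define l where "l = (LEAST l. S l)"
  have min: "\<not> S m" if "m < l" for m using that unfolding l_def by (rule not_less_Least)
  have "S l" unfolding l_def using \<open>\<exists>l. S l\<close> by (rule LeastI_ex)
  then obtain xs d ys zs where Wd: "W = xs @ d # ys @ prod.swap d # zs" "length ys = l"
    unfolding S_def by blast
  have ne: "ys \<noteq> []" and h: "hd ys \<noteq> prod.swap d" and la: "prod.swap d \<noteq> prod.swap (last ys)"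
    using nb unfolding Wd
    by (cases ys; auto simp: nonbacktracking_append nonbacktracking_Cons)+
  have wy: "walk adj (snd d) ys (snd d)" using w unfolding Wd by (auto simp: walk_append)
  have f: "fst (hd ys) = snd d" "snd (last ys) = snd d"
    using walk_fst_hd[OF wy ne] walk_snd_last[OF wy ne] by auto
  have mem: "hd ys \<in> set W" "last ys \<in> set W" "d \<in> set W" using ne unfolding Wd by auto
  have "hd ys \<noteq> prod.swap (last ys)"
  proof
    assume eq: "hd ys = prod.swap (last ys)"
    obtain y ys' where y: "ys = y # ys'" using ne by (cases ys) auto
    have "ys' \<noteq> []" using eq ir[OF mem(1)] y by auto
    then obtain ms z where "ys' = ms @ [z]" by (metis append_butlast_last_id)
    then have "ys = y # ms @ [prod.swap y]" using eq y by simp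
    then have "W = (xs @ [d]) @ y # ms @ prod.swap y # (prod.swap d # zs)" "length ms < l"
      using Wd by auto
    then show False using min S_def by blast
  qed
  then show ?thesis
    using that[of "hd ys" "prod.swap (last ys)" "prod.swap d"] h la f mem sw by auto
qed

text \<open>
  By the girth, the three nonbacktracking walks of length 4 that leave a branch vertex have pairwise
  distinct edges; this gives 12 edges, each of them used in both directions.
\<close>

lemma swap_closed_length:
  assumes W: "reduced_cycle adj W" and sw: "\<And>d. d \<in> set W \<Longrightarrow> prod.swap d \<in> set W"
  shows "24 \<le> length W"
proof -
  obtain y1 y2 y3 where y: "{y1, y2, y3} \<subseteq> set W" "fst y1 = fst y2" "fst y2 = fst y3"
    "y1 \<noteq> y2" "y1 \<noteq> y3" "y2 \<noteq> y3" using swap_closed_branch[OF W sw] by metis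
  obtain u where w: "walk adj u W u" using W by (auto simp: reduced_cycle_def)
  have "\<exists>e. e \<in> set W \<and> fst e = snd d \<and> e \<noteq> prod.swap d" if "d \<in> set W" for d
  proof -
    obtain xs ys where "W = xs @ d # ys" using \<open>d \<in> set W\<close> by (meson split_list)
    then have r: "reduced_cycle adj ([d] @ (ys @ xs))" and s: "set W = set ([d] @ ys @ xs)"
      using reduced_cycle_rotate[of adj xs "d # ys"] W by auto
    define Z where "Z = ys @ xs"
    have "Z \<noteq> []"
    proof
      assume "Z = []"
      then have "fst d = snd d" "adj (fst d) (snd d)"
        using r by (auto simp: reduced_cycle_def Z_def)
      then show False using irrefl by metis
    qed
    then have "fst (hd Z) = snd d" "hd Z \<noteq> prod.swap d" "hd Z \<in> set W"
      using r walk_fst_hd[of adj "snd d" Z] s unfolding Z_def[symmetric]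
      by (auto simp: reduced_cycle_def nonbacktracking_Cons)
    then show ?thesis by blast
  qed
  \<comment> \<open>One fixed follower for every dart: the walks \<open>P y\<close> built from it
    consist of darts of \<open>W\<close> but need not be contiguous in \<open>W\<close>.\<close>
  then obtain nx where nx: "\<And>d. d \<in> set W \<Longrightarrow> nx d \<in> set W"
    "\<And>d. d \<in> set W \<Longrightarrow> fst (nx d) = snd d" "\<And>d. d \<in> set W \<Longrightarrow> nx d \<noteq> prod.swap d"
    by metis
  define P where "P y = [y, nx y, nx (nx y), nx (nx (nx y))]" for y
  have PW: "set (P y) \<subseteq> set W" if "y \<in> set W" for y
    using that nx(1) by (auto simp: P_def)
  have Pw: "walk adj (fst y) (P y) (snd (nx (nx (nx y))))" if "y \<in> set W" for y
    proof -
    have nxW: "nx e \<in> set W \<and> fst (nx e) = snd e" if "e \<in> set W" for e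
      using that nx by blast
    have step: "adj (fst e) (snd e)" if "e \<in> set W" for e
      using walk_adj[OF w that] .
    define z1 z2 z3 where "z1 = nx y" and "z2 = nx z1" and "z3 = nx z2"
    have "z1 \<in> set W" "fst z1 = snd y" "z2 \<in> set W" "fst z2 = snd z1" "z3 \<in> set W" "fst z3 = snd z2"
      using nxW that unfolding z1_def z2_def z3_def by blast+
    then show ?thesis
      using step[OF that] step[of z1] step[of z2] step[of z3]
      unfolding P_def z1_def[symmetric] z2_def[symmetric] z3_def[symmetric] by simp
  qed
  have Pnb: "nonbacktracking (P y)" if "y \<in> set W" for y
    using that nx by (auto simp: P_def nonbacktracking_Cons)
  \<comment> \<open>Joined at their common start, two such walks form a walk of length 8, with no
    backtrack at the junction because \<open>y \<noteq> z\<close>.\<close>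
  have simple: "edge_simple (reversal (P y) @ P z)"
    if "y \<in> set W" "z \<in> set W" "fst y = fst z" "y \<noteq> z" for y z
  proof (rule nonbacktracking_edge_simple)
    show "walk adj (snd (nx (nx (nx y)))) (reversal (P y) @ P z) (snd (nx (nx (nx z))))"
      using walk_reversal[OF Pw[OF that(1)]] Pw[OF that(2)] that(3) by (auto simp: walk_append)
    have "hd (P z) = z" "last (reversal (P y)) = prod.swap y" by (simp_all add: P_def)
    then show "nonbacktracking (reversal (P y) @ P z)"
      using nonbacktracking_reversal[OF Pnb[OF that(1)]] Pnb[OF that(2)] that(4)
      by (auto simp: nonbacktracking_append)
  qed (simp add: P_def)
  have disj: "set (P y) \<inter> set (P z) = {}" "set (P y) \<inter> prod.swap ` set (P z) = {}"
    "prod.swap ` set (P y) \<inter> prod.swap ` set (P z) = {}"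
    "distinct (P y)" "set (P y) \<inter> prod.swap ` set (P y) = {}"
    if "y \<in> set W" "z \<in> set W" "fst y = fst z" "y \<noteq> z" for y z
    using edge_simple_reversal_append[OF simple[OF that]] by blast+
  define V where "V = P y1 @ P y2 @ P y3"
  have mem: "y1 \<in> set W" "y2 \<in> set W" "y3 \<in> set W" using y by auto
  have "fst y1 = fst y3" using y(2,3) by simp
  note d12 = disj[OF mem(1,2) y(2,4)] and d13 = disj[OF mem(1,3) \<open>fst y1 = fst y3\<close> y(5)]
    and d23 = disj[OF mem(2,3) y(3,6)]
    and d31 = disj[OF mem(3,1) \<open>fst y1 = fst y3\<close>[symmetric] y(5)[symmetric]]
    and d21 = disj[OF mem(2,1) y(2,4)[symmetric]] and d32 = disj[OF mem(3,2) y(3,6)[symmetric]]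
  have dV: "distinct V"
    unfolding V_def distinct_append set_append Int_Un_distrib
    using d12(1,4) d13(1) d23(1,4) d31(4) by blast
  have sV: "set V \<inter> prod.swap ` set V = {}"
    unfolding V_def set_append image_Un Int_Un_distrib Int_Un_distrib2
    using d12(2,5) d13(2) d21(2) d23(2,5) d31(2,5) d32(2) by blast
  have "card (set V \<union> prod.swap ` set V) = card (set V) + card (prod.swap ` set V)"
    using sV by (simp add: card_Un_disjoint)
  also have "\<dots> = 24"
    using dV by (simp add: card_image distinct_card) (simp add: V_def P_def)
  finally have "card (set V \<union> prod.swap ` set V) = 24" .
  moreover have "set V \<subseteq> set W"
    using PW mem unfolding V_def set_append by blast
  then have "set V \<union> prod.swap ` set V \<subseteq> set W"
    using sw by blast
  ultimately show ?thesis
    using card_mono[OF List.finite_set, of "set V \<union> prod.swap ` set V" W] card_length[of W] by linarith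
qed

end

subsection \<open>Tanner graphs\<close>

lemma tanner_adj_sym: "tanner_adj H u v \<Longrightarrow> tanner_adj H v u"
  by (auto simp: tanner_adj_def)

lemma tanner_adj_bipartite: "tanner_adj H u v \<Longrightarrow> isl v \<longleftrightarrow> \<not> isl u"
  by (auto simp: tanner_adj_def)

lemma tanner_adj_irrefl: "\<not> tanner_adj H u u"
  using tanner_adj_bipartite by blast

lemma tanner_adj_simps [simp]:
  "tanner_adj H (Inl i) (Inr j) \<longleftrightarrow> i < dim_row H \<and> j < dim_col H \<and> H $$ (i, j) = 1"
  "tanner_adj H (Inr j) (Inl i) \<longleftrightarrow> i < dim_row H \<and> j < dim_col H \<and> H $$ (i, j) = 1"
  "\<not> tanner_adj H (Inl i) (Inl i')" "\<not> tanner_adj H (Inr j) (Inr j')"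
  by (auto simp: tanner_adj_def)

lemma tanner_adj_cases:
  assumes "tanner_adj H u v"
  obtains i j where "u = Inl i" "v = Inr j" "i < dim_row H" "j < dim_col H" "H $$ (i, j) = 1"
  | i j where "u = Inr j" "v = Inl i" "i < dim_row H" "j < dim_col H" "H $$ (i, j) = 1"
  using assms by (auto simp: tanner_adj_def)

lemma girth_le: "graph_cycle (tanner_adj H) vs \<Longrightarrow> girth H \<le> enat (length vs)"
  unfolding girth_def by (rule INF_lower) simp

lemma girth_ge:
  "(\<And>vs. graph_cycle (tanner_adj H) vs \<Longrightarrow> g \<le> length vs) \<Longrightarrow> enat g \<le> girth H"
  unfolding girth_def by (rule INF_greatest) simp

lemma girth_attained:
  assumes "girth H = enat g"
  obtains vs where "graph_cycle (tanner_adj H) vs" "length vs = g"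
proof -
  define S where "S = (\<lambda>vs. enat (length vs)) ` {vs. graph_cycle (tanner_adj H) vs}"
  have S: "Inf S = enat g" using assms by (simp add: girth_def S_def)
  then have "S \<noteq> {}" by (auto simp: Inf_enat_def)
  then have "enat g \<in> S" using S LeastI_ex[of "\<lambda>x. x \<in> S"] by (auto simp: Inf_enat_def)
  then show ?thesis using that by (auto simp: S_def)
qed

lemma girth8_graph_tanner:
  assumes "girth H = 8"
  shows "girth8_graph (tanner_adj H) isl"
proof
  fix u W
  assume "walk (tanner_adj H) u W u" "W \<noteq> []" "nonbacktracking W"
  then obtain vs where vs: "graph_cycle (tanner_adj H) vs" "length vs \<le> length W"
    using graph_cycle_of_nonbacktracking[of "tanner_adj H", OF tanner_adj_irrefl] by blast
  then show "8 \<le> length W"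
    using girth_le[OF vs(1)] assms by (simp add: numeral_eq_enat)
qed (auto intro: tanner_adj_sym dest: tanner_adj_bipartite)

subsection \<open>Voltage assignments and liftings\<close>

definition voltage :: "(nat \<times> nat \<Rightarrow> int) \<Rightarrow> (nat + nat) \<times> (nat + nat) \<Rightarrow> int" where
  "voltage \<phi> d = (case d of (Inl i, Inr j) \<Rightarrow> \<phi> (i, j) | (Inr j, Inl i) \<Rightarrow> - \<phi> (i, j) | _ \<Rightarrow> 0)"

abbreviation total_voltage :: "(nat \<times> nat \<Rightarrow> int) \<Rightarrow> ((nat + nat) \<times> (nat + nat)) list \<Rightarrow> int" where
  "total_voltage \<phi> W \<equiv> sum_list (map (voltage \<phi>) W)"

text \<open>The congruence can use full indices instead of places within a block, since blocks start
  at multiples of \<open>N\<close>. Voltages are integers, not residues, so that they can be chosen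
  before \<open>N\<close>.\<close>

definition derived_by :: "bit mat \<Rightarrow> nat \<Rightarrow> (nat \<times> nat \<Rightarrow> int) \<Rightarrow> bit mat \<Rightarrow> bool" where
  "derived_by P N \<phi> H \<longleftrightarrow> 0 < N \<and> H \<in> carrier_mat (dim_row P * N) (dim_col P * N) \<and>
     (\<forall>x < dim_row P * N. \<forall>y < dim_col P * N. H $$ (x, y) = 1 \<longleftrightarrow>
        P $$ (x div N, y div N) = 1 \<and> int N dvd int y - int x - \<phi> (x div N, y div N))"

text \<open>The covering projection, used both from \<open>B\<close> to the protograph and from a
  lifting of \<open>B\<close> to \<open>B\<close>.\<close>

definition base :: "nat \<Rightarrow> nat + nat \<Rightarrow> nat + nat" where
  "base N = map_sum (\<lambda>x. x div N) (\<lambda>y. y div N)"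

definition position :: "nat + nat \<Rightarrow> int" where
  "position v = (case v of Inl x \<Rightarrow> int x | Inr y \<Rightarrow> int y)"

definition node :: "nat \<Rightarrow> nat + nat \<Rightarrow> int \<Rightarrow> nat + nat" where
  "node N p x = map_sum (\<lambda>i. i * N + nat (x mod int N)) (\<lambda>j. j * N + nat (x mod int N)) p"

primrec lift_walk ::
  "nat \<Rightarrow> (nat \<times> nat \<Rightarrow> int) \<Rightarrow> int \<Rightarrow> ((nat + nat) \<times> (nat + nat)) list \<Rightarrow> ((nat + nat) \<times> (nat + nat)) list" where
  "lift_walk N \<phi> x [] = []"
| "lift_walk N \<phi> x (d # W) =
     (node N (fst d) x, node N (snd d) (x + voltage \<phi> d)) # lift_walk N \<phi> (x + voltage \<phi> d) W"

lemma voltage_simps [simp]: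
  "voltage \<phi> (Inl i, Inr j) = \<phi> (i, j)" "voltage \<phi> (Inr j, Inl i) = - \<phi> (i, j)"
  by (simp_all add: voltage_def)

lemma voltage_swap: "voltage \<phi> (prod.swap d) = - voltage \<phi> d"
  by (auto simp: voltage_def split: prod.splits sum.splits)

lemma nat_mod_less: "0 < N \<Longrightarrow> nat (x mod int N) < N"
  using pos_mod_bound[of "int N" x] by (simp add: nat_less_iff)

lemma nat_mod_div [simp]: "0 < N \<Longrightarrow> nat (x mod int N) div N = 0"
  using nat_mod_less[of N x] by simp

lemma mult_add_less: "a < N \<Longrightarrow> i < m \<Longrightarrow> i * N + a < m * N" for a N i m :: nat
  using mult_le_mono1[of "Suc i" m N] by simp

lemma block_less: "0 < N \<Longrightarrow> i < m \<Longrightarrow> i * N + nat (x mod int N) < m * N"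
  using nat_mod_less mult_add_less by blast

lemma dvd_block: "0 < N \<Longrightarrow> int N dvd int (i * N + nat (x mod int N)) - x"
  by (simp add: mod_eq_dvd_iff[symmetric])

lemma base_node [simp]: "0 < N \<Longrightarrow> base N (node N p x) = p"
  by (cases p) (auto simp: base_def node_def)

lemma position_node: "0 < N \<Longrightarrow> int N dvd position (node N p x) - x"
  using dvd_block by (cases p) (auto simp: position_def node_def)

lemma base_position_inj:
  assumes "base N v = base N w" "int N dvd position v - position w"
  shows "v = w"
proof -
  have *: "x = y" if "x div N = y div N" "int N dvd int x - int y" for x y :: nat
  proof -
    have "int x mod int N = int y mod int N" using that(2) by (simp add: mod_eq_dvd_iff)
    then have "x mod N = y mod N" by (simp flip: zmod_int)
    then show ?thesis using that(1) by (metis div_mult_mod_eq)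
  qed
  show ?thesis using assms by (cases v; cases w) (auto simp: base_def position_def intro: *)
qed

lemma node_eqI:
  assumes "0 < N" "base N v = p" "int N dvd position v - x"
  shows "node N p x = v"
proof (rule base_position_inj)
  have "position (node N p x) - position v = (position (node N p x) - x) - (position v - x)" by simp
  then show "int N dvd position (node N p x) - position v"
    using position_node[OF assms(1)] assms(3) by (metis dvd_diff)
qed (use assms in simp)

lemma derived_adjD:
  assumes "derived_by P N \<phi> H" "tanner_adj H u v"
  shows "tanner_adj P (base N u) (base N v)"
    "int N dvd position v - position u - voltage \<phi> (base N u, base N v)"
proof -
  note D = assms(1)[unfolded derived_by_def]
  have *: "tanner_adj P (base N (Inl x)) (base N (Inr y)) \<and>
      int N dvd int y - int x - \<phi> (x div N, y div N)"
    if "x < dim_row H" "y < dim_col H" "H $$ (x, y) = 1" for x y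
    using D that by (auto simp: base_def less_mult_imp_div_less)
  \<comment> \<open>Running an edge backwards negates both the displacement and the voltage.\<close>
  have neg: "int N dvd a - b - c \<longleftrightarrow> int N dvd b - a - - c" for a b c
    using dvd_minus_iff[of "int N" "a - b - c"] by (simp add: algebra_simps)
  show "tanner_adj P (base N u) (base N v)"
    using assms(2) by (cases rule: tanner_adj_cases) (use * tanner_adj_sym in blast)+
  show "int N dvd position v - position u - voltage \<phi> (base N u, base N v)"
    using assms(2)
  proof (cases rule: tanner_adj_cases)
    case (2 i j)
    then show ?thesis using * neg[of "int j" "int i" "\<phi> (i div N, j div N)"]
      by (simp add: base_def position_def)
  qed (use * in \<open>simp add: base_def position_def\<close>)
qed

lemma derived_adjI:
  assumes "derived_by P N \<phi> H" "tanner_adj P p q"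
  shows "tanner_adj H (node N p x) (node N q (x + voltage \<phi> (p, q)))"
proof -
  note D = assms(1)[unfolded derived_by_def]
  have N: "0 < N" using D by simp
  have *: "tanner_adj H (node N (Inl i) x) (node N (Inr j) y)"
    if "i < dim_row P" "j < dim_col P" "P $$ (i, j) = 1" "y = x + \<phi> (i, j)" for i j x y
  proof -
    let ?x = "i * N + nat (x mod int N)" and ?y = "j * N + nat (y mod int N)"
    have "int ?y - int ?x - \<phi> (i, j) = (int ?y - y) - (int ?x - x)" using that(4) by simp
    then have "int N dvd int ?y - int ?x - \<phi> (i, j)"
      using dvd_block[OF N] by (metis dvd_diff)
    then show ?thesis using D that block_less[OF N that(1), of x] block_less[OF N that(2), of y] N
      by (auto simp: node_def)
  qed
  show ?thesis using assms(2)
  proof (cases rule: tanner_adj_cases)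
    case (2 i j)
    have "tanner_adj H (node N (Inl i) (x - \<phi> (i, j))) (node N (Inr j) x)"
      using 2 by (intro *) simp_all
    then show ?thesis using 2 tanner_adj_sym by simp
  qed (use * in simp)
qed

section \<open>Lifting and projecting walks\<close>

lemma length_lift_walk [simp]: "length (lift_walk N \<phi> x W) = length W"
  by (induction W arbitrary: x) auto

lemma lift_walk_append:
  "lift_walk N \<phi> x (V @ W) = lift_walk N \<phi> x V @ lift_walk N \<phi> (x + total_voltage \<phi> V) W"
  by (induction V arbitrary: x) (auto simp: add.assoc)

lemma map_base_lift_walk: "0 < N \<Longrightarrow> map (map_prod (base N) (base N)) (lift_walk N \<phi> x W) = W"
  by (induction W arbitrary: x) auto

lemma walk_lift_walk:
  assumes "derived_by P N \<phi> H"
  shows "walk (tanner_adj P) p W q \<Longrightarrow>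
    walk (tanner_adj H) (node N p x) (lift_walk N \<phi> x W) (node N q (x + total_voltage \<phi> W))"
proof (induction W arbitrary: p x)
  case (Cons d W)
  have "tanner_adj P p (snd d)" "fst d = p" using Cons.prems by auto
  then show ?case
    using Cons.IH[of "snd d" "x + voltage \<phi> d"] derived_adjI[OF assms, of p "snd d" x] Cons.prems
    by (cases d) (auto simp: add.assoc)
qed simp

lemma nonbacktracking_mapD:
  assumes "nonbacktracking (map (map_prod f f) W)"
  shows "nonbacktracking W"
  using assms by (induction W) (auto simp: nonbacktracking_Cons hd_map)

lemma node_cong: "int N dvd x - y \<Longrightarrow> node N p x = node N p y"
  by (simp add: node_def mod_eq_dvd_iff[symmetric])

text \<open>A total voltage divisible by \<open>N\<close> brings the lift back to its starting
  vertex, and a backtrack in the lift would project to one in \<open>W\<close>.\<close>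

lemma reduced_cycle_lift_walk:
  assumes D: "derived_by P N \<phi> H" and W: "reduced_cycle (tanner_adj P) W"
    and v: "int N dvd total_voltage \<phi> W"
  shows "reduced_cycle (tanner_adj H) (lift_walk N \<phi> x W)"
proof -
  have N: "0 < N" using D by (simp add: derived_by_def)
  obtain p where p: "walk (tanner_adj P) p W p" using W by (auto simp: reduced_cycle_def)
  have ne: "W \<noteq> []" using W by (simp add: reduced_cycle_def)
  have Lne: "lift_walk N \<phi> x W \<noteq> []" using ne by (metis length_0_conv length_lift_walk)
  have "node N p (x + total_voltage \<phi> W) = node N p x" by (rule node_cong) (simp add: v)
  then have "walk (tanner_adj H) (node N p x) (lift_walk N \<phi> x W) (node N p x)"
    using walk_lift_walk[OF D p, of x] by simp
  moreover have "map (map_prod (base N) (base N)) (lift_walk N \<phi> x W @ [hd (lift_walk N \<phi> x W)])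
      = W @ [hd W]"
    using map_base_lift_walk[OF N, of \<phi> x W] hd_map[OF Lne, of "map_prod (base N) (base N)"]
    by simp
  then have "nonbacktracking (lift_walk N \<phi> x W @ [hd (lift_walk N \<phi> x W)])"
    using W nonbacktracking_mapD unfolding reduced_cycle_def by metis
  ultimately show ?thesis using Lne by (auto simp: reduced_cycle_def)
qed

lemma walk_project:
  assumes D: "derived_by P N \<phi> H"
  shows "walk (tanner_adj H) u W v \<Longrightarrow>
    walk (tanner_adj P) (base N u) (map (map_prod (base N) (base N)) W) (base N v) \<and>
    int N dvd position v - position u - total_voltage \<phi> (map (map_prod (base N) (base N)) W)"
proof (induction W arbitrary: u)
  case (Cons d W)
  let ?t = "total_voltage \<phi> (map (map_prod (base N) (base N)) W)"
  have d: "tanner_adj H u (snd d)" "fst d = u" using Cons.prems by auto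
  have IH: "walk (tanner_adj P) (base N (snd d)) (map (map_prod (base N) (base N)) W) (base N v)"
    "int N dvd position v - position (snd d) - ?t"
    using Cons by auto
  have "position v - position u - (voltage \<phi> (base N u, base N (snd d)) + ?t) =
      (position (snd d) - position u - voltage \<phi> (base N u, base N (snd d)))
      + (position v - position (snd d) - ?t)"
    by simp
  then have "int N dvd position v - position u - (voltage \<phi> (base N u, base N (snd d)) + ?t)"
    using derived_adjD(2)[OF D d(1)] IH(2) by (simp only: dvd_add)
  then show ?case using derived_adjD(1)[OF D d(1)] IH(1) d(2) by (cases d) simp
qed simp

text \<open>The voltage fixes the residue of a neighbour over a given base vertex. This covering
  property keeps nonbacktracking walks nonbacktracking under projection.\<close>

lemma derived_locally_injective:
  assumes D: "derived_by P N \<phi> H" and "tanner_adj H v u" "tanner_adj H v w" "base N u = base N w"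
  shows "u = w"
proof (rule base_position_inj[OF assms(4)])
  have "int N dvd (position u - position v - voltage \<phi> (base N v, base N u)) -
      (position w - position v - voltage \<phi> (base N v, base N w))"
    using derived_adjD(2)[OF D assms(2)] derived_adjD(2)[OF D assms(3)] by (rule dvd_diff)
  then show "int N dvd position u - position w" using assms(4) by simp
qed

lemma nonbacktracking_project:
  assumes D: "derived_by P N \<phi> H"
  shows "walk (tanner_adj H) u W v \<Longrightarrow> nonbacktracking W \<Longrightarrow>
    nonbacktracking (map (map_prod (base N) (base N)) W)"
proof (induction W arbitrary: u)
  case (Cons d W)
  show ?case
  proof (cases W)
    case (Cons e W')
    have e: "tanner_adj H (snd d) (snd e)" "tanner_adj H (snd d) (fst d)" "fst e = snd d"
      using Cons.prems Cons by (auto intro: tanner_adj_sym)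
    have "base N (snd e) \<noteq> base N (fst d)"
      using derived_locally_injective[OF D e(1,2)] Cons.prems(2) Cons e(3)
      by (auto simp: nonbacktracking_Cons prod_eq_iff)
    then show ?thesis using Cons.IH[of "snd d"] Cons.prems Cons
      by (auto simp: nonbacktracking_Cons prod_eq_iff)
  qed simp
qed simp

lemma reduced_cycle_project:
  assumes D: "derived_by P N \<phi> H" and W: "reduced_cycle (tanner_adj H) W"
  shows "reduced_cycle (tanner_adj P) (map (map_prod (base N) (base N)) W)"
    "int N dvd total_voltage \<phi> (map (map_prod (base N) (base N)) W)"
proof -
  let ?f = "map (map_prod (base N) (base N))"
  obtain u where u: "walk (tanner_adj H) u W u" and ne: "W \<noteq> []"
    and nb: "nonbacktracking (W @ [hd W])" using W by (auto simp: reduced_cycle_def)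
  have "fst (hd W) = u" "tanner_adj H (fst (hd W)) (snd (hd W))"
    using walk_fst_hd[OF u ne] walk_adj[OF u hd_in_set[OF ne]] by auto
  \<comment> \<open>The first dart is walked again so that the projection also covers the turn at
    the base point.\<close>
  then have "walk (tanner_adj H) u (W @ [hd W]) (snd (hd W))"
    using u by (auto simp: walk_append)
  from nonbacktracking_project[OF D this nb]
  have "nonbacktracking (?f W @ [hd (?f W)])" using ne by (simp add: hd_map)
  then show "reduced_cycle (tanner_adj P) (?f W)"
    using walk_project[OF D u] ne by (auto simp: reduced_cycle_def)
  show "int N dvd total_voltage \<phi> (?f W)" using walk_project[OF D u] by simp
qed

section \<open>Liftings as derived matrices\<close>

lemma bit_eq_if: "(x = 1 \<longleftrightarrow> Q) \<Longrightarrow> x = (if Q then 1 else 0)" for x :: bit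
  by auto

lemma derived_by_is_lifting:
  assumes "derived_by P N \<phi> H"
  shows "is_lifting P N H"
proof -
  note D = assms[unfolded derived_by_def]
  have N: "0 < N" using D by simp
  have entry: "H $$ (i * N + a, j * N + b) = (if P $$ (i, j) = 1 \<and> b = (a + nat (\<phi> (i, j) mod int N)) mod N then 1 else 0)"
    if ij: "i < dim_row P" "j < dim_col P" and ab: "a < N" "b < N" for i j a b
  proof -
    have bound: "i * N + a < dim_row P * N" "j * N + b < dim_col P * N"
      using ij ab mult_add_less by blast+
    have "int N dvd int (j * N + b) - int (i * N + a) - \<phi> (i, j) \<longleftrightarrow>
        int N dvd int b - (int a + \<phi> (i, j))"
    proof -
      have "int (j * N + b) - int (i * N + a) - \<phi> (i, j) =
          int N * (int j - int i) + (int b - (int a + \<phi> (i, j)))"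
        by (simp add: algebra_simps)
      then show ?thesis by (metis dvd_add_right_iff dvd_triv_left)
    qed
    also have "\<dots> \<longleftrightarrow> int b mod int N = (int a + \<phi> (i, j)) mod int N"
      by (simp add: mod_eq_dvd_iff)
    also have "(int a + \<phi> (i, j)) mod int N = int ((a + nat (\<phi> (i, j) mod int N)) mod N)"
      using N by (simp add: zmod_int mod_add_right_eq)
    also have "int b mod int N = int b" using ab by simp
    finally have "int N dvd int (j * N + b) - int (i * N + a) - \<phi> (i, j) \<longleftrightarrow>
        b = (a + nat (\<phi> (i, j) mod int N)) mod N"
      by (simp only: of_nat_eq_iff)
    moreover have "H $$ (i * N + a, j * N + b) = 1 \<longleftrightarrow> P $$ (i, j) = 1 \<and>
        int N dvd int (j * N + b) - int (i * N + a) - \<phi> (i, j)"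
      using D bound ab by simp
    ultimately have "H $$ (i * N + a, j * N + b) = 1 \<longleftrightarrow>
        P $$ (i, j) = 1 \<and> b = (a + nat (\<phi> (i, j) mod int N)) mod N"
      by (simp only:)
    then show ?thesis by (rule bit_eq_if)
  qed
  have "if P $$ (i, j) = 1 then is_circulant_perm_mat N (mat_block N H i j)
      else mat_block N H i j = 0\<^sub>m N N" if "i < dim_row P" "j < dim_col P" for i j
  proof (cases "P $$ (i, j) = 1")
    case True
    have "mat_block N H i j = circulant_perm_mat N (nat (\<phi> (i, j) mod int N))"
      unfolding mat_block_def circulant_perm_mat_def
      by (rule cong_mat) (use entry[OF that] True in auto)
    then show ?thesis using True nat_mod_less[OF N] by (auto simp: is_circulant_perm_mat_def)
  next
    case False
    have "mat_block N H i j = 0\<^sub>m N N"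
      unfolding mat_block_def zero_mat_def
      by (rule cong_mat) (use entry[OF that] False in auto)
    then show ?thesis using False by simp
  qed
  then show ?thesis using D by (auto simp: is_lifting_def)
qed

lemma is_lifting_derived_by:
  assumes "is_lifting P N H"
  obtains \<phi> where "derived_by P N \<phi> H"
proof -
  note L = assms[unfolded is_lifting_def]
  have N: "0 < N" using L by simp
  have "\<exists>s. P $$ (i, j) = 1 \<longrightarrow> mat_block N H i j = circulant_perm_mat N s"
    if "i < dim_row P" "j < dim_col P" for i j
    using L that unfolding is_circulant_perm_mat_def by meson
  then obtain s where s: "\<And>i j. i < dim_row P \<Longrightarrow> j < dim_col P \<Longrightarrow> P $$ (i, j) = 1 \<Longrightarrow>
      mat_block N H i j = circulant_perm_mat N (s i j)"
    by metis
  have "H $$ (x, y) = 1 \<longleftrightarrow> P $$ (x div N, y div N) = 1 \<and>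
      int N dvd int y - int x - int (s (x div N) (y div N))"
    if xy: "x < dim_row P * N" "y < dim_col P * N" for x y
  proof -
    define i j a b where "i = x div N" and "j = y div N" and "a = x mod N" and "b = y mod N"
    have ij: "i < dim_row P" "j < dim_col P" and ab: "a < N" "b < N"
      using xy N by (auto simp: i_def j_def a_def b_def less_mult_imp_div_less)
    have "H $$ (x, y) = mat_block N H i j $$ (a, b)"
      using ab by (simp add: mat_block_def i_def j_def a_def b_def)
    also have "\<dots> = 1 \<longleftrightarrow> P $$ (i, j) = 1 \<and> b = (a + s i j) mod N"
    proof (cases "P $$ (i, j) = 1")
      case True
      then show ?thesis using s[OF ij True] ab by (simp add: circulant_perm_mat_def)
    next
      case False
      then have "mat_block N H i j = 0\<^sub>m N N" using L ij by auto
      then show ?thesis using False ab by simp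
    qed
    also have "b = (a + s i j) mod N \<longleftrightarrow> int N dvd int y - int x - int (s i j)"
    proof -
      have "int N dvd int y - int x - int (s i j) \<longleftrightarrow> int y mod int N = (int x + int (s i j)) mod int N"
        by (simp add: mod_eq_dvd_iff algebra_simps)
      also have "\<dots> \<longleftrightarrow> y mod N = (x + s i j) mod N"
        by (metis of_nat_add of_nat_eq_iff of_nat_mod)
      finally show ?thesis by (simp add: a_def b_def mod_add_left_eq)
    qed
    finally show ?thesis by (simp add: i_def j_def)
  qed
  then have "derived_by P N (\<lambda>(i, j). int (s i j)) H"
    using L by (auto simp: derived_by_def)
  then show ?thesis by (rule that)
qed

subsection \<open>Liftings of prescribed girth\<close>

definition dart :: "nat \<times> nat \<Rightarrow> (nat + nat) \<times> (nat + nat)" where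
  "dart e = (Inl (fst e), Inr (snd e))"

text \<open>The 1-chain of the walk; the total voltage is a linear form in it, by
  \<open>total_voltage_net_count\<close>.\<close>

definition net_count :: "((nat + nat) \<times> (nat + nat)) list \<Rightarrow> nat \<times> nat \<Rightarrow> int" where
  "net_count W e = int (count_list W (dart e)) - int (count_list W (prod.swap (dart e)))"

definition entries :: "'a mat \<Rightarrow> (nat \<times> nat) set" where
  "entries P = {..<dim_row P} \<times> {..<dim_col P}"

lemma finite_entries [simp]: "finite (entries P)"
  by (simp add: entries_def)

lemma tanner_dart_cases:
  assumes "tanner_adj P (fst d) (snd d)"
  obtains e where "e \<in> entries P" "d = dart e" | e where "e \<in> entries P" "d = prod.swap (dart e)"
  using assms
proof (cases rule: tanner_adj_cases)
  case (1 i j)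
  then show ?thesis using that(1)[of "(i, j)"] by (auto simp: dart_def entries_def prod_eq_iff)
next
  case (2 i j)
  then show ?thesis using that(2)[of "(i, j)"] by (auto simp: dart_def entries_def prod_eq_iff)
qed

lemma dart_simps [simp]:
  "dart e = dart e' \<longleftrightarrow> e = e'" "prod.swap (dart e) = dart e' \<longleftrightarrow> False"
  "dart e = prod.swap (dart e') \<longleftrightarrow> False" "prod.swap (dart e) = prod.swap (dart e') \<longleftrightarrow> e = e'"
  "voltage \<phi> (dart e) = \<phi> e"
  by (auto simp: dart_def prod_eq_iff)

lemma total_voltage_net_count:
  assumes "\<And>d. d \<in> set W \<Longrightarrow> tanner_adj P (fst d) (snd d)"
  shows "total_voltage \<phi> W = (\<Sum>e\<in>entries P. net_count W e * \<phi> e)"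
  using assms
proof (induction W)
  case (Cons d W)
  have IH: "total_voltage \<phi> W = (\<Sum>e\<in>entries P. net_count W e * \<phi> e)"
    using Cons by simp
  have "voltage \<phi> d = (\<Sum>e\<in>entries P. net_count [d] e * \<phi> e)"
    using Cons.prems[of d, simplified]
  proof (cases rule: tanner_dart_cases)
    case (1 e)
    then have "(\<Sum>e'\<in>entries P. net_count [d] e' * \<phi> e') = (\<Sum>e'\<in>entries P. if e = e' then \<phi> e' else 0)"
      by (intro sum.cong) (auto simp: net_count_def)
    then show ?thesis using 1 by simp
  next
    case (2 e)
    then have "(\<Sum>e'\<in>entries P. net_count [d] e' * \<phi> e') = (\<Sum>e'\<in>entries P. if e = e' then - \<phi> e' else 0)"
      by (intro sum.cong) (auto simp: net_count_def)
    then show ?thesis using 2 by (simp add: voltage_swap)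
  qed
  moreover have "net_count (d # W) e = net_count [d] e + net_count W e" for e
    by (simp add: net_count_def)
  ultimately show ?case using IH by (simp add: sum.distrib distrib_right)
qed (simp add: net_count_def)

lemma sum_counts:
  assumes "\<And>d. d \<in> set W \<Longrightarrow> tanner_adj P (fst d) (snd d)"
  shows "(\<Sum>e\<in>entries P. count_list W (dart e) + count_list W (prod.swap (dart e))) = length W"
  using assms
proof (induction W)
  case (Cons d W)
  let ?c = "\<lambda>W e. count_list W (dart e) + count_list W (prod.swap (dart e))"
  have "\<exists>e\<in>entries P. \<forall>e'. ?c [d] e' = (if e = e' then 1 else 0)"
    using Cons.prems[of d, simplified] by (cases rule: tanner_dart_cases) force+
  then obtain e where "e \<in> entries P" "\<And>e'. ?c [d] e' = (if e = e' then 1 else 0)" by blast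
  then have "(\<Sum>e\<in>entries P. ?c [d] e) = 1" by simp
  moreover have "?c (d # W) e = ?c [d] e + ?c W e" for e by simp
  ultimately show ?case using Cons by (simp only: sum.distrib) simp
qed simp

lemma sum_abs_net_count_le:
  assumes "\<And>d. d \<in> set W \<Longrightarrow> tanner_adj P (fst d) (snd d)"
  shows "(\<Sum>e\<in>entries P. \<bar>net_count W e\<bar>) \<le> int (length W)"
proof -
  have "(\<Sum>e\<in>entries P. \<bar>net_count W e\<bar>) \<le>
      (\<Sum>e\<in>entries P. int (count_list W (dart e) + count_list W (prod.swap (dart e))))"
    by (rule sum_mono) (simp add: net_count_def)
  then show ?thesis by (simp only: sum_counts[OF assms] flip: of_nat_sum)
qed

text \<open>No edge is run both ways, so nothing cancels at any entry.\<close>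

lemma sum_abs_net_count_eq:
  assumes "\<And>d. d \<in> set W \<Longrightarrow> tanner_adj P (fst d) (snd d)"
    and "\<And>d. d \<in> set W \<Longrightarrow> prod.swap d \<notin> set W"
  shows "(\<Sum>e\<in>entries P. \<bar>net_count W e\<bar>) = int (length W)"
proof -
  have "(\<Sum>e\<in>entries P. \<bar>net_count W e\<bar>) =
      (\<Sum>e\<in>entries P. int (count_list W (dart e) + count_list W (prod.swap (dart e))))"
  proof (rule sum.cong)
    fix e
    have "count_list W (dart e) = 0 \<or> count_list W (prod.swap (dart e)) = 0"
      using assms(2) by (metis count_notin)
    then show "\<bar>net_count W e\<bar> = int (count_list W (dart e) + count_list W (prod.swap (dart e)))"
      by (auto simp: net_count_def)
  qed simp
  then show ?thesis by (simp only: sum_counts[OF assms(1)] flip: of_nat_sum)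
qed

section \<open>Generic integer voltages\<close>

text \<open>Each new weight exceeds every value that the earlier ones can produce from coefficients
  bounded by \<open>K\<close>, as in a positional number system; so the leading coefficient of a
  vanishing sum is 0.\<close>

lemma separating_voltage:
  fixes K :: int
  assumes "finite E"
  shows "\<exists>\<psi>. \<forall>v. (\<forall>e\<in>E. \<bar>v e\<bar> \<le> K) \<longrightarrow> (\<Sum>e\<in>E. v e * \<psi> e) = 0 \<longrightarrow> (\<forall>e\<in>E. v e = 0)"
  using assms
proof induction
  case (insert x E)
  then obtain \<psi> where \<psi>: "\<And>v. \<forall>e\<in>E. \<bar>v e\<bar> \<le> K \<Longrightarrow> (\<Sum>e\<in>E. v e * \<psi> e) = 0 \<Longrightarrow> \<forall>e\<in>E. v e = 0"
    by blast
  define M where "M = 1 + (\<Sum>e\<in>E. K * \<bar>\<psi> e\<bar>)"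
  have "\<forall>e\<in>insert x E. v e = 0"
    if b: "\<forall>e\<in>insert x E. \<bar>v e\<bar> \<le> K" and z: "(\<Sum>e\<in>insert x E. v e * (\<psi>(x := M)) e) = 0" for v
  proof -
    have "(\<Sum>e\<in>E. v e * (\<psi>(x := M)) e) = (\<Sum>e\<in>E. v e * \<psi> e)"
      using insert.hyps by (intro sum.cong) auto
    then have s: "v x * M + (\<Sum>e\<in>E. v e * \<psi> e) = 0" using z insert.hyps by simp
    have "\<bar>\<Sum>e\<in>E. v e * \<psi> e\<bar> \<le> (\<Sum>e\<in>E. \<bar>v e * \<psi> e\<bar>)" by (rule sum_abs)
    also have "\<dots> \<le> (\<Sum>e\<in>E. K * \<bar>\<psi> e\<bar>)"
      using b by (intro sum_mono) (auto simp: abs_mult intro: mult_right_mono)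
    finally have lt: "\<bar>\<Sum>e\<in>E. v e * \<psi> e\<bar> < M" by (simp add: M_def)
    have "v x = 0"
    proof (rule ccontr)
      assume "v x \<noteq> 0"
      then have "\<bar>M\<bar> \<le> \<bar>v x * M\<bar>"
        using mult_right_mono[of 1 "\<bar>v x\<bar>" "\<bar>M\<bar>"] by (simp add: abs_mult)
      then show False using s lt by linarith
    qed
    moreover have "\<forall>e\<in>E. v e = 0"
      by (rule \<psi>) (use b s \<open>v x = 0\<close> in simp_all)
    ultimately show ?thesis by simp
  qed
  then show ?case by blast
qed simp

text \<open>Subtracting from \<open>v\<close> the multiple of \<open>w\<close> that clears the
  coordinate \<open>e0\<close> leaves a vector with the same sum against \<open>\<phi>\<close> and
  \<open>\<psi>\<close>, to which \<open>separating_voltage\<close> applies. A modulus beyond all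
  attainable sums turns divisibility into vanishing.\<close>

lemma generic_voltage:
  fixes w :: "'e \<Rightarrow> int" and K :: int
  assumes E: "finite E" "e0 \<in> E" and w0: "\<bar>w e0\<bar> = 1" and K: "0 \<le> K"
  obtains \<phi> :: "'e \<Rightarrow> int" and N :: nat where "0 < N" "(\<Sum>e\<in>E. w e * \<phi> e) = 0"
    "\<forall>v. (\<forall>e\<in>E. \<bar>v e\<bar> \<le> K) \<longrightarrow> int N dvd (\<Sum>e\<in>E. v e * \<phi> e) \<longrightarrow> (\<exists>m. \<forall>e\<in>E. v e = m * w e)"
proof -
  \<comment> \<open>This bounds \<open>v - m * w\<close> for \<open>\<bar>m\<bar> \<le> K\<close>,
    the vector to be tested against \<open>\<psi>\<close>.\<close>
  define K' where "K' = K * (1 + (\<Sum>e\<in>E. \<bar>w e\<bar>))"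
  obtain \<psi> where \<psi>: "\<And>v. \<forall>e\<in>E. \<bar>v e\<bar> \<le> K' \<Longrightarrow> (\<Sum>e\<in>E. v e * \<psi> e) = 0 \<Longrightarrow> \<forall>e\<in>E. v e = 0"
    using separating_voltage[OF E(1), of K'] by blast
  \<comment> \<open>The value at \<open>e0\<close> is forced by \<open>(\<Sum>e\<in>E. w e * \<phi> e) = 0\<close>, as \<open>w e0\<close> is its own inverse.\<close>
  define \<phi> where "\<phi> = \<psi>(e0 := - w e0 * (\<Sum>e\<in>E - {e0}. w e * \<psi> e))"
  define M where "M = (\<Sum>e\<in>E. K * \<bar>\<phi> e\<bar>)"
  have M: "0 \<le> M" using K by (auto simp: M_def intro: sum_nonneg)
  have w0': "w e0 * w e0 = 1" using w0 by (metis abs_mult_self_eq mult_1)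
  have \<phi>_off: "(\<Sum>e\<in>E - {e0}. u e * \<phi> e) = (\<Sum>e\<in>E - {e0}. u e * \<psi> e)" for u
    by (intro sum.cong) (auto simp: \<phi>_def)
  have "(\<Sum>e\<in>E. w e * \<phi> e) = w e0 * \<phi> e0 + (\<Sum>e\<in>E - {e0}. w e * \<phi> e)"
    using E by (simp add: sum.remove)
  also have "\<dots> = w e0 * (- w e0 * (\<Sum>e\<in>E - {e0}. w e * \<psi> e)) + (\<Sum>e\<in>E - {e0}. w e * \<psi> e)"
    by (simp only: \<phi>_off) (simp add: \<phi>_def)
  also have "\<dots> = (1 - w e0 * w e0) * (\<Sum>e\<in>E - {e0}. w e * \<psi> e)"
    by (simp add: algebra_simps)
  finally have w\<phi>: "(\<Sum>e\<in>E. w e * \<phi> e) = 0" by (simp add: w0')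
  have "\<exists>m. \<forall>e\<in>E. v e = m * w e"
    if b: "\<forall>e\<in>E. \<bar>v e\<bar> \<le> K" and d: "int (nat (1 + M)) dvd (\<Sum>e\<in>E. v e * \<phi> e)" for v
  proof -
    have "\<bar>\<Sum>e\<in>E. v e * \<phi> e\<bar> \<le> (\<Sum>e\<in>E. \<bar>v e * \<phi> e\<bar>)" by (rule sum_abs)
    also have "\<dots> \<le> M"
      unfolding M_def using b by (intro sum_mono) (auto simp: abs_mult intro: mult_right_mono)
    finally have v0: "(\<Sum>e\<in>E. v e * \<phi> e) = 0"
      using d M dvd_imp_le_int[of "\<Sum>e\<in>E. v e * \<phi> e" "int (nat (1 + M))"] by fastforce
    \<comment> \<open>As \<open>w e0\<close> is 1 or -1, this choice makes \<open>u\<close> vanish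
      at \<open>e0\<close>.\<close>
    define m where "m = v e0 * w e0"
    define u where "u e = v e - m * w e" for e
    have u0: "u e0 = 0" by (simp add: u_def m_def mult.assoc w0')
    have "(\<Sum>e\<in>E. u e * \<phi> e) = (\<Sum>e\<in>E. v e * \<phi> e) - m * (\<Sum>e\<in>E. w e * \<phi> e)"
      by (simp add: u_def left_diff_distrib sum_subtractf sum_distrib_left mult.assoc)
    then have "(\<Sum>e\<in>E. u e * \<phi> e) = 0" by (simp add: v0 w\<phi>)
    then have "(\<Sum>e\<in>E - {e0}. u e * \<phi> e) = 0"
      using E u0 by (simp add: sum.remove)
    then have "(\<Sum>e\<in>E. u e * \<psi> e) = 0"
      using E u0 by (simp add: sum.remove \<phi>_off)
    moreover have "\<forall>e\<in>E. \<bar>u e\<bar> \<le> K'"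
    proof
      fix e assume e: "e \<in> E"
      have "\<bar>w e\<bar> \<le> (\<Sum>e\<in>E. \<bar>w e\<bar>)" using E(1) e by (intro member_le_sum) auto
      moreover have "\<bar>m\<bar> \<le> K" using b E(2) w0 by (simp add: m_def abs_mult)
      ultimately have "\<bar>m * w e\<bar> \<le> K * (\<Sum>e\<in>E. \<bar>w e\<bar>)"
        unfolding abs_mult using K by (intro mult_mono) auto
      moreover have "\<bar>v e\<bar> \<le> K" using b e by simp
      moreover have "\<bar>u e\<bar> \<le> \<bar>v e\<bar> + \<bar>m * w e\<bar>" by (simp add: u_def)
      ultimately show "\<bar>u e\<bar> \<le> K'" unfolding K'_def distrib_left by linarith
    qed
    ultimately have "\<forall>e\<in>E. u e = 0" using \<psi> by blast
    then show ?thesis by (auto simp: u_def)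
  qed
  then show ?thesis using that[of "nat (1 + M)" \<phi>] M w\<phi> by auto
qed

section \<open>The girth of a generic lifting\<close>

lemma exists_derived:
  assumes "0 < N"
  obtains H where "derived_by P N \<phi> H"
proof
  show "derived_by P N \<phi> (mat (dim_row P * N) (dim_col P * N) (\<lambda>(x, y).
      if P $$ (x div N, y div N) = 1 \<and> int N dvd int y - int x - \<phi> (x div N, y div N) then 1 else 0))"
    using assms by (auto simp: derived_by_def)
qed

text \<open>The dart \<open>d0\<close> provides the entry of net count 1 or -1 that
  \<open>generic_voltage\<close> asks for; the bound 24 is the one of
  \<open>swap_closed_length\<close>.\<close>

lemma lifting_with_girth_of_cycle:
  assumes B: "girth B = 8"
    and W: "reduced_cycle (tanner_adj B) W" "length W \<le> 24"
    and opp: "\<And>d. d \<in> set W \<Longrightarrow> prod.swap d \<notin> set W"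
    and d0: "count_list W d0 = 1"
  shows "\<exists>N H. is_lifting B N H \<and> girth H = enat (length W)"
proof -
  note B' = girth8_graph_tanner[OF B]
  have darts: "tanner_adj B (fst d) (snd d)" if "reduced_cycle (tanner_adj B) V" "d \<in> set V" for V d
    using walk_adj[OF reduced_cycle_walk[OF that(1)] that(2)] .
  have "d0 \<in> set W" using d0 by (metis count_notin zero_neq_one)
  then have "prod.swap d0 \<notin> set W" using opp by blast
  have "\<exists>e0\<in>entries B. \<bar>net_count W e0\<bar> = 1"
    using darts[OF W(1) \<open>d0 \<in> set W\<close>]
  proof (cases rule: tanner_dart_cases)
    case (1 e)
    then show ?thesis using d0 \<open>prod.swap d0 \<notin> set W\<close> by (auto simp: net_count_def intro!: bexI[of _ e])
  next
    case (2 e)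
    then show ?thesis using d0 \<open>prod.swap d0 \<notin> set W\<close> by (auto simp: net_count_def intro!: bexI[of _ e])
  qed
  then obtain e0 where e0: "e0 \<in> entries B" "\<bar>net_count W e0\<bar> = 1" by blast
  obtain \<phi> N where N: "0 < N" "(\<Sum>e\<in>entries B. net_count W e * \<phi> e) = 0"
    and gen: "\<forall>v. (\<forall>e\<in>entries B. \<bar>v e\<bar> \<le> int (length W)) \<longrightarrow>
      int N dvd (\<Sum>e\<in>entries B. v e * \<phi> e) \<longrightarrow> (\<exists>m. \<forall>e\<in>entries B. v e = m * net_count W e)"
    by (rule generic_voltage[of "entries B" e0 "net_count W" "int (length W)"])
      (use e0 in simp_all)
  obtain H where H: "derived_by B N \<phi> H" using exists_derived[OF N(1)] .
  have "girth H \<le> enat (length W)"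
  proof -
    have "total_voltage \<phi> W = 0" using total_voltage_net_count[OF darts[OF W(1)]] N(2) by simp
    then have r: "reduced_cycle (tanner_adj H) (lift_walk N \<phi> 0 W)"
      using reduced_cycle_lift_walk[OF H W(1)] by simp
    obtain vs where "graph_cycle (tanner_adj H) vs" "length vs \<le> length (lift_walk N \<phi> 0 W)"
      using graph_cycle_of_nonbacktracking[of "tanner_adj H", OF tanner_adj_irrefl reduced_cycle_walk[OF r]
          reduced_cycle_nonempty[OF r] reduced_cycle_nonbacktracking[OF r]] .
    then show ?thesis using girth_le by (metis enat_ord_simps(1) length_lift_walk order_trans)
  qed
  moreover have "enat (length W) \<le> girth H"
  proof (rule girth_ge, rule ccontr)
    fix vs assume vs: "graph_cycle (tanner_adj H) vs" and "\<not> length W \<le> length vs"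
    then have lt: "length vs < length W" by simp
    obtain V' where V': "reduced_cycle (tanner_adj H) V'" "length V' = length vs"
      using reduced_cycle_of_graph_cycle[OF vs] .
    define V where "V = map (map_prod (base N) (base N)) V'"
    have V: "reduced_cycle (tanner_adj B) V" "int N dvd total_voltage \<phi> V" "length V = length vs"
      using reduced_cycle_project[OF H V'(1)] V'(2) by (simp_all add: V_def)
    note dV = darts[OF V(1)]
    \<comment> \<open>Shorter closed walks have net counts within the range for which
      \<open>\<phi>\<close> is generic.\<close>
    have "\<bar>net_count V e\<bar> \<le> int (length W)" for e
      using count_le_length[of V "dart e"] count_le_length[of V "prod.swap (dart e)"] lt V(3)
      by (simp add: net_count_def)
    then obtain m where m: "\<forall>e\<in>entries B. net_count V e = m * net_count W e"
      using gen[rule_format, of "net_count V"] V(2) total_voltage_net_count[OF dV] by auto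
    show False
    proof (cases "m = 0")
      case True
      \<comment> \<open>All net counts of \<open>V\<close> are 0, so each edge is used equally often
        in both directions.\<close>
      have "prod.swap d \<in> set V" if "d \<in> set V" for d
        using dV[OF that]
      proof (cases rule: tanner_dart_cases)
        case (1 e)
        then have "count_list V (prod.swap d) = count_list V d"
          using m True by (auto simp: net_count_def)
        then show ?thesis using that by (metis count_list_0_iff)
      next
        case (2 e)
        then have "count_list V (prod.swap d) = count_list V d"
          using m True by (auto simp: net_count_def)
        then show ?thesis using that by (metis count_list_0_iff)
      qed
      then have "24 \<le> length V" using girth8_graph.swap_closed_length[OF B' V(1)] by blast
      then show False using lt V(3) W(2) by simp
    next
      case False
      \<comment> \<open>The sum of absolute net counts equals the length for \<open>W\<close>, and
        bounds the length from below for \<open>V\<close>.\<close>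
      have "int (length W) = (\<Sum>e\<in>entries B. \<bar>net_count W e\<bar>)"
        using sum_abs_net_count_eq[OF darts[OF W(1)] opp] by simp
      also have "\<dots> \<le> (\<Sum>e\<in>entries B. \<bar>net_count V e\<bar>)"
      proof (rule sum_mono)
        fix e assume "e \<in> entries B"
        then show "\<bar>net_count W e\<bar> \<le> \<bar>net_count V e\<bar>"
          using m False mult_right_mono[of 1 "\<bar>m\<bar>" "\<bar>net_count W e\<bar>"] by (simp add: abs_mult)
      qed
      also have "\<dots> \<le> int (length V)" by (rule sum_abs_net_count_le[OF dV])
      finally show False using lt V(3) by simp
    qed
  qed
  ultimately show ?thesis using derived_by_is_lifting[OF H] by (metis order_antisym)
qed

section \<open>From closed walks in the protograph to cycles in \<open>B\<close>\<close>

lemma count_list_distinct: "distinct xs \<Longrightarrow> x \<in> set xs \<Longrightarrow> count_list xs x = 1"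
  by (induction xs) auto

text \<open>Unique path lifting. It makes the lift of a template start with the prescribed darts of
  the 8-cycle.\<close>

lemma lift_walk_project:
  assumes D: "derived_by P N \<phi> H"
  shows "walk (tanner_adj H) u A v \<Longrightarrow> int N dvd position u - x \<Longrightarrow>
    lift_walk N \<phi> x (map (map_prod (base N) (base N)) A) = A"
proof (induction A arbitrary: u x)
  case (Cons d A)
  have N: "0 < N" using D by (simp add: derived_by_def)
  have d: "fst d = u" "tanner_adj H u (snd d)" using Cons.prems by auto
  let ?c = "voltage \<phi> (base N u, base N (snd d))"
  have "position (snd d) - (x + ?c) = (position (snd d) - position u - ?c) + (position u - x)" by simp
  then have x': "int N dvd position (snd d) - (x + ?c)"
    using derived_adjD(2)[OF D d(2)] Cons.prems(2) by (simp only: dvd_add)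
  then show ?case
    using Cons.IH[OF _ x'] Cons.prems node_eqI[OF N refl Cons.prems(2)] node_eqI[OF N refl x'] d(1)
    by (cases d) simp
qed simp

text \<open>Length above 8 forces the lift to leave the 8-cycle; length at most 14 is what
  \<open>compatible_cycles\<close> accepts and keeps the combined walk within 24.\<close>

definition template ::
  "bit mat \<Rightarrow> (nat \<times> nat \<Rightarrow> int) \<Rightarrow> ((nat + nat) \<times> (nat + nat)) list \<Rightarrow> bool" where
  "template P \<phi> V \<longleftrightarrow> reduced_cycle (tanner_adj P) V \<and> total_voltage \<phi> V = 0 \<and>
     9 \<le> length V \<and> length V \<le> 14"

text \<open>Lifted from the position of \<open>u\<close>, the template becomes a cycle of length
  \<open>2 + length V\<close> that begins with \<open>A\<close>, like the 8-cycle. Made compatible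
  and glued, the two have total length \<open>10 + length V\<close>.\<close>

lemma lifting_with_girth_of_template:
  assumes D: "derived_by P N\<^sub>1 \<phi> B" and B: "girth B = 8"
    and C: "reduced_cycle (tanner_adj B) (A @ C2)" "length (A @ C2) = 8" "length A = 2"
    and T: "template P \<phi> (map (map_prod (base N\<^sub>1) (base N\<^sub>1)) A @ V)"
  shows "\<exists>N H. is_lifting B N H \<and> girth H = enat (10 + length V)"
proof -
  note B' = girth8_graph_tanner[OF B]
  let ?A = "map (map_prod (base N\<^sub>1) (base N\<^sub>1)) A"
  have V: "reduced_cycle (tanner_adj P) (?A @ V)" "total_voltage \<phi> (?A @ V) = 0"
    "7 \<le> length V" "length V \<le> 12"
    using T C(3) by (simp_all add: template_def)
  obtain u v where A: "walk (tanner_adj B) u A v"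
    using C(1) by (auto simp: reduced_cycle_def walk_append)
  define D2 where "D2 = lift_walk N\<^sub>1 \<phi> (position u + total_voltage \<phi> ?A) V"
  have "lift_walk N\<^sub>1 \<phi> (position u) (?A @ V) = A @ D2"
    using lift_walk_project[OF D A] by (simp add: lift_walk_append D2_def)
  moreover have "reduced_cycle (tanner_adj B) (lift_walk N\<^sub>1 \<phi> (position u) (?A @ V))"
    using V(2) by (intro reduced_cycle_lift_walk[OF D V(1)]) (simp only: dvd_0_right)
  ultimately have D2: "reduced_cycle (tanner_adj B) (A @ D2)" by simp
  have len: "length (A @ D2) = 2 + length V" using C(3) by (simp add: D2_def)
  have "length (A @ D2) \<le> 14" using len V(4) by simp
  then obtain P Q R where P: "P \<noteq> []" and PQ: "reduced_cycle (tanner_adj B) (P @ Q)"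
    and PR: "reduced_cycle (tanner_adj B) (P @ R)" and l: "length (P @ Q) = 8"
    "length (P @ R) = length (A @ D2)" and opp: "\<forall>b \<in> set (P @ R). prod.swap b \<notin> set (P @ Q)"
    using girth8_graph.compatible_cycles[OF B' C(1,2) D2 _ C(3)] by metis
  define W where "W = (P @ Q) @ (P @ R)"
  have es: "edge_simple (P @ Q)" "edge_simple (P @ R)"
    using girth8_graph.reduced_cycle_edge_simple[OF B' PQ]
      girth8_graph.reduced_cycle_edge_simple[OF B' PR] l len V(4) by auto
  have W: "reduced_cycle (tanner_adj B) W" "length W = 10 + length V"
    using reduced_cycle_concat[OF P PQ PR] l len by (simp_all add: W_def)
  have "prod.swap d \<notin> set W" if "d \<in> set W" for d
  proof -
    have "d \<in> set (P @ Q) \<or> d \<in> set (P @ R)" using that by (auto simp: W_def)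
    then have "prod.swap d \<notin> set (P @ Q) \<and> prod.swap d \<notin> set (P @ R)"
      using es opp unfolding edge_simple_def by (metis swap_swap)
    then show ?thesis by (simp add: W_def)
  qed
  moreover have "\<exists>d0. count_list W d0 = 1"
  proof -
    \<comment> \<open>Both cycles are edge-simple and the long one has more than 8 edges, so one of
      its darts is off the 8-cycle and occurs just once in \<open>W\<close>.\<close>
    have "\<not> set (P @ R) \<subseteq> set (P @ Q)"
    proof
      assume "set (P @ R) \<subseteq> set (P @ Q)"
      then have "card (set (P @ R)) \<le> card (set (P @ Q))" by (intro card_mono) auto
      moreover have "card (set (P @ R)) = length (P @ R)" "card (set (P @ Q)) = length (P @ Q)"
        using es unfolding edge_simple_def by (blast intro: distinct_card)+
      ultimately show False using l len V(3) by simp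
    qed
    then obtain d0 where d0: "d0 \<in> set (P @ R)" "d0 \<notin> set (P @ Q)" by blast
    have "distinct (P @ R)" using es(2) by (simp add: edge_simple_def)
    then have "count_list (P @ R) d0 = 1" using d0(1) count_list_distinct by metis
    moreover have "count_list (P @ Q) d0 = 0" using d0(2) by (simp add: count_list_0_iff)
    ultimately have "count_list W d0 = 1" by (simp only: W_def count_list_append)
    then show ?thesis by blast
  qed
  ultimately show ?thesis
    using lifting_with_girth_of_cycle[OF B W(1)] W(2) V(4) by auto
qed

section \<open>Templates in the all-one protograph\<close>

lemma ex_third: "3 \<le> n \<Longrightarrow> \<exists>c < n. c \<noteq> a \<and> c \<noteq> b" for n a b :: nat
proof -
  assume "3 \<le> n"
  have "card {a, b} \<le> 2" by (simp add: card_insert_if)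
  then have "\<not> {..<n} \<subseteq> {a, b}" using \<open>3 \<le> n\<close> card_mono[of "{a, b}" "{..<n}"] by auto
  then show ?thesis by auto
qed

lemma all_one_protograph_simps [simp]:
  "dim_row (all_one_protograph n_c n_v) = n_c" "dim_col (all_one_protograph n_c n_v) = n_v"
  "i < n_c \<Longrightarrow> j < n_v \<Longrightarrow> all_one_protograph n_c n_v $$ (i, j) = 1"
  by (auto simp: all_one_protograph_def)

text \<open>The path is the projection of three consecutive darts of an 8-cycle; the inequalities
  come from the lack of backtracking. The template has to follow the first two darts, while
  \<open>k\<close> offers a second column.\<close>

lemma protograph_path:
  fixes n_c n_v :: nat
  defines "P \<equiv> all_one_protograph n_c n_v"
  assumes D: "derived_by P N\<^sub>1 \<phi> B" and B: "girth B = 8"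
  obtains i j i' k where "i < n_c" "j < n_v" "i' < n_c" "k < n_v" "i \<noteq> i'" "j \<noteq> k"
    "\<And>V. template P \<phi> ([(Inl i, Inr j), (Inr j, Inl i')] @ V) \<Longrightarrow>
      \<exists>N H. is_lifting B N H \<and> girth H = enat (10 + length V)"
proof -
  have P [simp]: "dim_row P = n_c" "dim_col P = n_v"
    "\<And>i j. i < n_c \<Longrightarrow> j < n_v \<Longrightarrow> P $$ (i, j) = 1"
    by (simp_all add: P_def)
  let ?f = "map_prod (base N\<^sub>1) (base N\<^sub>1)"
  obtain vs where vs: "graph_cycle (tanner_adj B) vs" "length vs = 8"
    using girth_attained[of B 8] B by (auto simp: numeral_eq_enat)
  obtain C0 where C0: "reduced_cycle (tanner_adj B) C0" "length C0 = 8"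
    using reduced_cycle_of_graph_cycle[OF vs(1)] vs(2) by metis
  \<comment> \<open>The path is to start at a check node; if necessary, the 8-cycle is rotated by
    one dart.\<close>
  obtain C where C: "reduced_cycle (tanner_adj B) C" "length C = 8" "isl (fst (hd C))"
  proof (cases "isl (fst (hd C0))")
    case False
    obtain d e C1 where C1: "C0 = d # e # C1" using C0(2) by (auto simp: numeral_eq_Suc length_Suc_conv)
    then have "tanner_adj B (fst d) (fst e)" using C0(1) by (auto simp: reduced_cycle_def)
    then have "isl (fst e)" using False C1 tanner_adj_bipartite by auto
    then show ?thesis using that[of "(e # C1) @ [d]"] reduced_cycle_rotate[of _ "[d]" "e # C1"] C0 C1 by simp
  qed (use that C0 in blast)
  obtain d1 d2 d3 C3 where C123: "C = d1 # d2 # d3 # C3" using C(2) by (auto simp: numeral_eq_Suc length_Suc_conv)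
  have proj: "reduced_cycle (tanner_adj P) (map ?f C)" using reduced_cycle_project(1)[OF D C(1)] .
  obtain x where "fst d1 = Inl x" using C(3) C123 by (auto simp: isl_def)
  define i where "i = x div N\<^sub>1"
  have f1: "fst (?f d1) = Inl i" using \<open>fst d1 = Inl x\<close> by (cases d1) (simp add: base_def i_def)
  note pw = reduced_cycle_walk[OF proj] and pnb = reduced_cycle_nonbacktracking[OF proj]
  have links: "fst (?f d2) = snd (?f d1)" "fst (?f d3) = snd (?f d2)"
    "tanner_adj P (fst (?f d1)) (snd (?f d1))" "tanner_adj P (fst (?f d2)) (snd (?f d2))"
    "tanner_adj P (fst (?f d3)) (snd (?f d3))"
    and nb: "?f d2 \<noteq> prod.swap (?f d1)" "?f d3 \<noteq> prod.swap (?f d2)"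
    using pw pnb unfolding C123 by (auto simp: nonbacktracking_Cons)
  obtain j where j: "snd (?f d1) = Inr j" "i < n_c" "j < n_v"
    using links(3) f1 by (cases "snd (?f d1)") auto
  obtain i' where i': "snd (?f d2) = Inl i'" "i' < n_c"
    using links(1,4) j by (cases "snd (?f d2)") auto
  obtain k where k: "snd (?f d3) = Inr k" "k < n_v"
    using links(2,5) i' by (cases "snd (?f d3)") auto
  have d12: "?f d1 = (Inl i, Inr j)" "?f d2 = (Inr j, Inl i')" "?f d3 = (Inl i', Inr k)"
    using f1 j i' k links by (metis prod.collapse)+
  have ne: "i \<noteq> i'" "j \<noteq> k" using nb d12 by auto
  have lift: "\<exists>N H. is_lifting B N H \<and> girth H = enat (10 + length V)"
    if "template P \<phi> ([(Inl i, Inr j), (Inr j, Inl i')] @ V)" for V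
    by (rule lifting_with_girth_of_template[OF D B, of "[d1, d2]" "d3 # C3"])
      (use C C123 that d12 in simp_all)
  show ?thesis
    by (rule that[OF j(2,3) i'(2) k(2) ne]) (rule lift)
qed

text \<open>The template runs through the theta graph of three paths of length 2 between the rows
  \<open>i\<close> and \<open>i'\<close>. Each of the 6 edges is used once in each direction, so all
  voltages cancel and the length is 12.\<close>

lemma lifting_girth_20_of_three_columns:
  assumes D: "derived_by (all_one_protograph n_c n_v) N\<^sub>1 \<phi> B" and B: "girth B = 8"
    and n: "3 \<le> n_v"
  shows "\<exists>N H. is_lifting B N H \<and> girth H = 20"
proof -
  obtain i j i' k where path: "i < n_c" "j < n_v" "i' < n_c" "k < n_v" and ne: "i \<noteq> i'" "j \<noteq> k"
    and lift: "\<And>V. template (all_one_protograph n_c n_v) \<phi> ([(Inl i, Inr j), (Inr j, Inl i')] @ V) \<Longrightarrow>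
      \<exists>N H. is_lifting B N H \<and> girth H = enat (10 + length V)"
    using protograph_path[OF D B] by metis
  obtain l where l: "l < n_v" "l \<noteq> j" "l \<noteq> k" using ex_third[OF n] by blast
  show ?thesis
    using lift[of "[(Inl i', Inr k), (Inr k, Inl i), (Inl i, Inr l), (Inr l, Inl i'), (Inl i', Inr j),
      (Inr j, Inl i), (Inl i, Inr k), (Inr k, Inl i'), (Inl i', Inr l), (Inr l, Inl i)]"]
      ne l path
    by (simp add: template_def reduced_cycle_def nonbacktracking_Cons numeral_eq_enat)
qed

text \<open>The transposed template: the three paths of length 2 join the columns \<open>j\<close>
  and \<open>k\<close>.\<close>

lemma lifting_girth_20_of_three_rows:
  assumes D: "derived_by (all_one_protograph n_c n_v) N\<^sub>1 \<phi> B" and B: "girth B = 8"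
    and n: "3 \<le> n_c"
  shows "\<exists>N H. is_lifting B N H \<and> girth H = 20"
proof -
  obtain i j i' k where path: "i < n_c" "j < n_v" "i' < n_c" "k < n_v" and ne: "i \<noteq> i'" "j \<noteq> k"
    and lift: "\<And>V. template (all_one_protograph n_c n_v) \<phi> ([(Inl i, Inr j), (Inr j, Inl i')] @ V) \<Longrightarrow>
      \<exists>N H. is_lifting B N H \<and> girth H = enat (10 + length V)"
    using protograph_path[OF D B] by metis
  obtain i'' where l: "i'' < n_c" "i'' \<noteq> i" "i'' \<noteq> i'" using ex_third[OF n] by blast
  show ?thesis
    using lift[of "[(Inl i', Inr k), (Inr k, Inl i''), (Inl i'', Inr j), (Inr j, Inl i), (Inl i, Inr k),
      (Inr k, Inl i'), (Inl i', Inr j), (Inr j, Inl i''), (Inl i'', Inr k), (Inr k, Inl i)]"]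
      ne l path
    by (simp add: template_def reduced_cycle_def nonbacktracking_Cons numeral_eq_enat)
qed

text \<open>The theta graph now consists of the edge between row \<open>i\<close> and column
  \<open>j\<close> and two paths of length 3 joining them, through \<open>k\<close>,
  \<open>i'\<close> and through \<open>l\<close>, \<open>i''\<close>. Its 7 edges, each used once in
  each direction, give length 14.\<close>

lemma lifting_girth_22:
  assumes D: "derived_by (all_one_protograph n_c n_v) N\<^sub>1 \<phi> B" and B: "girth B = 8"
    and n: "3 \<le> n_c" "3 \<le> n_v"
  shows "\<exists>N H. is_lifting B N H \<and> girth H = 22"
proof -
  obtain i j i' k where path: "i < n_c" "j < n_v" "i' < n_c" "k < n_v" and ne: "i \<noteq> i'" "j \<noteq> k"
    and lift: "\<And>V. template (all_one_protograph n_c n_v) \<phi> ([(Inl i, Inr j), (Inr j, Inl i')] @ V) \<Longrightarrow>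
      \<exists>N H. is_lifting B N H \<and> girth H = enat (10 + length V)"
    using protograph_path[OF D B] by metis
  obtain i'' where i'': "i'' < n_c" "i'' \<noteq> i" "i'' \<noteq> i'" using ex_third[OF n(1)] by blast
  obtain l where l: "l < n_v" "l \<noteq> j" "l \<noteq> k" using ex_third[OF n(2)] by blast
  show ?thesis
    using lift[of "[(Inl i', Inr k), (Inr k, Inl i), (Inl i, Inr l), (Inr l, Inl i''), (Inl i'', Inr j),
      (Inr j, Inl i), (Inl i, Inr k), (Inr k, Inl i'), (Inl i', Inr j), (Inr j, Inl i''),
      (Inl i'', Inr l), (Inr l, Inl i)]"]
      ne l i'' path
    by (simp add: template_def reduced_cycle_def nonbacktracking_Cons numeral_eq_enat)
qed

text \<open>The size conditions are necessary. For a 2 by 2 protograph all cycles of a lifting of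
  \<open>B\<close> have length divisible by 8; with just two rows or just two columns all cycle
  lengths are divisible by 4, which excludes 22.\<close>

theorem theorem56:
  fixes n_c n_v N\<^sub>1 :: nat and B :: "bit mat"
  assumes "is_lifting (all_one_protograph n_c n_v) N\<^sub>1 B"
    and "girth B = 8"
  shows "(3 \<le> n_c \<or> 3 \<le> n_v \<longrightarrow> (\<exists>N H. is_lifting B N H \<and> girth H = 20)) \<and>
         (3 \<le> n_c \<and> 3 \<le> n_v \<longrightarrow> (\<exists>N H. is_lifting B N H \<and> girth H = 22))"
proof -
  obtain \<phi> where "derived_by (all_one_protograph n_c n_v) N\<^sub>1 \<phi> B"
    using is_lifting_derived_by[OF assms(1)] .
  then show ?thesis
    using lifting_girth_20_of_three_columns lifting_girth_20_of_three_rows lifting_girth_22 assms(2)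
    by blast
qed

end
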